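(* Let $\mathcal G:\mathscr P_2(\mathbb R^d)\to\mathbb R$ be locally Lipschitz around $\mu\in\mathscr P_2(\mathbb R^d)$, and let $\operatorname{Lip}_\mu(\mathcal G)$ be a Lipschitz constant of $\mathcal G$ in a neighborhood of $\mu$. Then: i) For every $w\in C_1(\mathbb R^d;\mathbb R^d)$, $|D\mathcal G(\mu)(w)|\le\operatorname{Lip}_\mu(\mathcal G)\|w\|_\mu$. ii) For every $w_1,w_2\in C_1(\mathbb R^d;\mathbb R^d)$, $|D\mathcal G(\mu)(w_2)-D\mathcal G(\mu)(w_1)|\le\operatorname{Lip}_\mu(\mathcal G)\|w_2-w_1\|_\mu$. iii) $D\mathcal G(\mu)$ admits a unique continuous extension to $L^2_\mu$ (still denoted $D\mathcal G(\mu)$), which is positively homogeneous and $\operatorname{Lip}_\mu(\mathcal G)$-Lipschitz continuous. iv) For any $w\in C_1(\mathbb R^d;\mathbb R^d)$, the mapping $\nu\mapsto D\mathcal G(\nu)(w)$, defined for $\nu$ in a neighborhood of $\mu$ on which $\mathcal G$ is Lipschitz, is upper semicontinuous for the topology of $\mathscr P_2(\mathbb R^d)$. v) $\partial_C\mathcal G(\mu)$ is nonempty, convex and weakly closed in $L^2_\mu$. vi) For every $\Xi\in\partial_C\mathcal G(\mu)$, $\|\Xi\|_\mu\le\operatorname{Lip}_\mu(\mathcal G)$. vii) For every $\beta\in L^2_\mu$, $D\mathcal G(\mu)(\beta)=\sigma_{\partial_C\mathcal G(\mu)}(\beta):=\sup_{\Xi\in\partial_C\mathcal G(\mu)}\l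angle\Xi,\beta\rangle_\mu$.
   Context: $\mathscr P_2(\mathbb R^d)$ is the space of Borel probability measures on $\mathbb R^d$ with finite second moment, endowed with the 2-Wasserstein distance $d_{\mathcal W}$ and its topology. $L^2_\mu$ is the space of $\mu$-square-integrable maps $\mathbb R^d\to\mathbb R^d$ with inner product $\langle\cdot,\cdot\rangle_\mu$ and norm $\|\cdot\|_\mu$. $C_1(\mathbb R^d;\mathbb R^d)$ is the set of continuous maps $w:\mathbb R^d\to\mathbb R^d$ with $\sup_x|w(x)|/(1+|x|)<\infty$. For $\mathcal G$ locally Lipschitz around $\mu$ (i.e. Lipschitz in some $d_{\mathcal W}$-neighborhood of $\mu$) and $w\in C_1(\mathbb R^d;\mathbb R^d)$, the generalized derivative is $$D\mathcal G(\mu)(w):=\limsup_{\nu\to\mu,\ t\searrow0}\frac{\mathcal G((\mathrm{id}+tw)_\#\nu)-\mathcal G(\nu)}{t},$$ and the Clarke subdifferential is $\partial_C\mathcal G(\mu):=\{\Xi\in L^2_\mu:\ \langle\Xi,w\rangle_\mu\le D\mathcal G(\mu)(w)\ \ \forall w\in C_1(\mathbb R^d;\mathbb R^d)\}$. *)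

theory Defs
  imports "HOL-Probability.Probability"
begin

section \<open>The Wasserstein space\<close>

definition P2 :: "'a::euclidean_space measure set" where
  "P2 = {\<mu>. prob_space \<mu> \<and> sets \<mu> = sets borel \<and> integrable \<mu> (\<lambda>x. (norm x)\<^sup>2)}"

definition couplings ::
  "'a::euclidean_space measure \<Rightarrow> 'a measure \<Rightarrow> ('a \<times> 'a) measure set" where
  "couplings \<mu> \<nu> =
     {\<pi>. sets \<pi> = sets (borel \<Otimes>\<^sub>M borel) \<and> distr \<pi> borel fst = \<mu> \<and> distr \<pi> borel snd = \<nu>}"

text \<open>
  Only used for measures in \<^const>\<open>P2\<close>: there the set of couplings contains the product
  measure, and the cost is integrable for every coupling, so neither the Bochner integral
  nor the real infimum takes a default value.
\<close>

definition W2 :: "'a::euclidean_space measure \<Rightarrow> 'a measure \<Rightarrow> real" where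
  "W2 \<mu> \<nu> = sqrt (INF \<pi>\<in>couplings \<mu> \<nu>. \<integral>p. (dist (fst p) (snd p))\<^sup>2 \<partial>\<pi>)"

definition W2_ball :: "'a::euclidean_space measure \<Rightarrow> real \<Rightarrow> 'a measure set" where
  "W2_ball \<mu> r = {\<nu> \<in> P2. W2 \<mu> \<nu> < r}"

definition W2_open :: "'a::euclidean_space measure set \<Rightarrow> bool" where
  "W2_open U \<longleftrightarrow> U \<subseteq> P2 \<and> (\<forall>\<mu>\<in>U. \<exists>r>0. W2_ball \<mu> r \<subseteq> U)"

text \<open>The neighbourhood filter in \<^const>\<open>P2\<close>; as for \<^const>\<open>nhds\<close>, the point is not removed.\<close>

definition W2_nhds :: "'a::euclidean_space measure \<Rightarrow> 'a measure filter" where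
  "W2_nhds \<mu> = (INF r\<in>{0<..}. principal (W2_ball \<mu> r))"

definition W2_lipschitz_on ::
  "real \<Rightarrow> 'a::euclidean_space measure set \<Rightarrow> ('a measure \<Rightarrow> real) \<Rightarrow> bool" where
  "W2_lipschitz_on L S \<G> \<longleftrightarrow> 0 \<le> L \<and> (\<forall>\<nu>\<in>S. \<forall>\<nu>'\<in>S. \<bar>\<G> \<nu> - \<G> \<nu>'\<bar> \<le> L * W2 \<nu> \<nu>')"

definition W2_lipschitz_around ::
  "real \<Rightarrow> 'a::euclidean_space measure \<Rightarrow> ('a measure \<Rightarrow> real) \<Rightarrow> bool" where
  "W2_lipschitz_around L \<mu> \<G> \<longleftrightarrow> (\<exists>r>0. W2_lipschitz_on L (W2_ball \<mu> r) \<G>)"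

definition W2_usc_on ::
  "'a::euclidean_space measure set \<Rightarrow> ('a measure \<Rightarrow> ereal) \<Rightarrow> bool" where
  "W2_usc_on U F \<longleftrightarrow> (\<forall>\<nu>\<in>U. Limsup (inf (W2_nhds \<nu>) (principal U)) F \<le> F \<nu>)"


section \<open>Square-integrable maps\<close>

text \<open>
  Elements of the Hilbert space are represented by Borel maps, not by classes of maps that agree
  almost everywhere; \<open>L2_norm\<close> is then a seminorm that vanishes exactly on the maps
  that are zero almost everywhere. A function on \<open>L2\<close> that is continuous for this
  seminorm is constant on the classes, and the weak topology does not separate
  representatives of one class either.
\<close>

definition L2 :: "'a::euclidean_space measure \<Rightarrow> ('a \<Rightarrow> 'a) set" where
  "L2 \<mu> = {f. f \<in> borel_measurable \<mu> \<and> integrable \<mu> (\<lambda>x. (norm (f x))\<^sup>2)}"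

definition L2_inner :: "'a::euclidean_space measure \<Rightarrow> ('a \<Rightarrow> 'a) \<Rightarrow> ('a \<Rightarrow> 'a) \<Rightarrow> real" where
  "L2_inner \<mu> f g = (\<integral>x. f x \<bullet> g x \<partial>\<mu>)"

definition L2_norm :: "'a::euclidean_space measure \<Rightarrow> ('a \<Rightarrow> 'a) \<Rightarrow> real" where
  "L2_norm \<mu> f = sqrt (\<integral>x. (norm (f x))\<^sup>2 \<partial>\<mu>)"

definition L2_continuous ::
  "'a::euclidean_space measure \<Rightarrow> (('a \<Rightarrow> 'a) \<Rightarrow> real) \<Rightarrow> bool" where
  "L2_continuous \<mu> E \<longleftrightarrow>
     (\<forall>f\<in>L2 \<mu>. \<forall>\<epsilon>>0. \<exists>\<delta>>0. \<forall>g\<in>L2 \<mu>. L2_norm \<mu> (\<lambda>x. g x - f x) < \<delta> \<longrightarrow> \<bar>E g - E f\<bar> < \<epsilon>)"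

definition L2_weak_topology :: "'a::euclidean_space measure \<Rightarrow> ('a \<Rightarrow> 'a) topology" where
  "L2_weak_topology \<mu> =
     topology_generated_by {{f \<in> L2 \<mu>. L2_inner \<mu> f g \<in> V} | g V. g \<in> L2 \<mu> \<and> open V}"

definition L2_convex :: "('a::euclidean_space \<Rightarrow> 'a) set \<Rightarrow> bool" where
  "L2_convex S \<longleftrightarrow>
     (\<forall>f\<in>S. \<forall>g\<in>S. \<forall>s\<in>{0..1}. (\<lambda>x. (1 - s) *\<^sub>R f x + s *\<^sub>R g x) \<in> S)"


section \<open>The generalized derivative and the Clarke subdifferential\<close>

definition C1 :: "('a::euclidean_space \<Rightarrow> 'a) set" where
  "C1 = {w. continuous_on UNIV w \<and> bdd_above (range (\<lambda>x. norm (w x) / (1 + norm x)))}"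

text \<open>
  The upper limit is taken in the extended reals, so its finiteness is part of what is
  claimed about it.
\<close>

definition gen_deriv ::
  "('a::euclidean_space measure \<Rightarrow> real) \<Rightarrow> 'a measure \<Rightarrow> ('a \<Rightarrow> 'a) \<Rightarrow> ereal" where
  "gen_deriv \<G> \<mu> w =
     Limsup (W2_nhds \<mu> \<times>\<^sub>F at_right 0)
       (\<lambda>(\<nu>, t). ereal ((\<G> (distr \<nu> borel (\<lambda>x. x + t *\<^sub>R w x)) - \<G> \<nu>) / t))"

definition clarke_subdiff ::
  "('a::euclidean_space measure \<Rightarrow> real) \<Rightarrow> 'a measure \<Rightarrow> ('a \<Rightarrow> 'a) set" where
  "clarke_subdiff \<G> \<mu> = {\<Xi> \<in> L2 \<mu>. \<forall>w\<in>C1. ereal (L2_inner \<mu> \<Xi> w) \<le> gen_deriv \<G> \<mu> w}"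

text \<open>
  Membership in \<^const>\<open>extensional\<close> fixes the values outside \<^const>\<open>L2\<close>,
  so that uniqueness of the extension can be expressed as equality of functions.
\<close>

definition is_cont_extension ::
  "('a::euclidean_space measure \<Rightarrow> real) \<Rightarrow> 'a measure \<Rightarrow> (('a \<Rightarrow> 'a) \<Rightarrow> real) \<Rightarrow> bool" where
  "is_cont_extension \<G> \<mu> E \<longleftrightarrow>
     E \<in> extensional (L2 \<mu>) \<and> L2_continuous \<mu> E \<and> (\<forall>w\<in>C1. ereal (E w) = gen_deriv \<G> \<mu> w)"

definition gen_deriv_ext ::
  "('a::euclidean_space measure \<Rightarrow> real) \<Rightarrow> 'a measure \<Rightarrow> ('a \<Rightarrow> 'a) \<Rightarrow> real" where
  "gen_deriv_ext \<G> \<mu> = (THE E. is_cont_extension \<G> \<mu> E)"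

end

theory Submission
  imports Defs
begin

text \<open>
  The estimate \<open>W2 (f # \<nu>) (g # \<nu>) \<le> \<parallel>f - g\<parallel>\<close> turns the Lipschitz bound on the functional into a Lipschitz
  bound on difference quotients; the norm of a continuous map of linear growth depends upper
  semicontinuously on the base measure, so the bound survives the upper limit. The derivative is
  positively homogeneous, and it is subadditive because the upper limit also runs over base points.
  By density it extends to a sublinear Lipschitz functional on all square-integrable maps, and
  its subdifferential at the origin is the Clarke subdifferential. Minimizing Moreau envelopes of this
  functional produces subgradients at points arbitrarily close to a given one; this yields
  nonemptiness and the support function formula.
\<close>

section \<open>Square-integrable maps on an arbitrary measure space\<close>

text \<open>Square integrability is set up over an arbitrary measure space because two nearby
  measures are compared through random variables on the space of a coupling, and several couplings
  through a gluing. Couplings are taken nearly optimal; the strict inequalities that define balls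
  leave room for this, and also for a gluing with an arbitrarily small defect. The obstacle is that
  the base measure moves while the maps are merely continuous: no Lipschitz constant of
  \<open>w\<close> controls the norm of \<open>w\<close> under a nearby measure, or the increment of
  \<open>w\<close> under a small displacement. Both are settled by
  \<open>C1_composition_continuous\<close>, where the admissible distance depends on the law of the
  reference variable and not on the space or on the perturbed variable. In the Moreau argument the
  minimizer lies within \<open>L / (2 * a)\<close> of the given point \<open>b\<close>, so a
  subgradient attains \<open>E b\<close> up to the square of \<open>L\<close> over
  \<open>2 * a\<close>. Letting \<open>a\<close> grow turns this into the supremum formula.\<close>

definition sq_integrable :: "'b measure \<Rightarrow> ('b \<Rightarrow> 'a::euclidean_space) \<Rightarrow> bool" where
  "sq_integrable M f \<longleftrightarrow> f \<in> borel_measurable M \<and> integrable M (\<lambda>x. (norm (f x))\<^sup>2)"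

definition norm2 :: "'b measure \<Rightarrow> ('b \<Rightarrow> 'a::euclidean_space) \<Rightarrow> real" where
  "norm2 M f = sqrt (\<integral>x. (norm (f x))\<^sup>2 \<partial>M)"

lemma sq_integrable_measurable: "sq_integrable M f \<Longrightarrow> f \<in> borel_measurable M"
  by (simp add: sq_integrable_def)

lemma norm2_nonneg [simp]: "0 \<le> norm2 M f"
  by (simp add: norm2_def)

lemma norm2_power2: "(norm2 M f)\<^sup>2 = (\<integral>x. (norm (f x))\<^sup>2 \<partial>M)"
  by (simp add: norm2_def)

lemma sq_integrable_bound:
  fixes f :: "'b \<Rightarrow> 'a::euclidean_space"
  assumes "f \<in> borel_measurable M" "integrable M h" "AE x in M. (norm (f x))\<^sup>2 \<le> h x"
  shows "sq_integrable M f"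
  unfolding sq_integrable_def using assms
  by (auto intro!: Bochner_Integration.integrable_bound[OF assms(2)])

lemma sq_integrable_scaleR:
  assumes "sq_integrable M f"
  shows "sq_integrable M (\<lambda>x. c *\<^sub>R f x)"
  using assms by (auto simp: sq_integrable_def power_mult_distrib)

lemma sq_integrable_add:
  fixes f g :: "'b \<Rightarrow> 'a::euclidean_space"
  assumes "sq_integrable M f" "sq_integrable M g"
  shows "sq_integrable M (\<lambda>x. f x + g x)"
proof (rule sq_integrable_bound[where h = "\<lambda>x. 2 * (norm (f x))\<^sup>2 + 2 * (norm (g x))\<^sup>2"])
  have "(norm (a + b))\<^sup>2 \<le> 2 * (norm a)\<^sup>2 + 2 * (norm b)\<^sup>2" for a b :: 'a
  proof -
    have "(norm (a + b))\<^sup>2 \<le> (norm a + norm b)\<^sup>2"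
      by (intro power_mono norm_triangle_ineq) auto
    also have "\<dots> \<le> 2 * (norm a)\<^sup>2 + 2 * (norm b)\<^sup>2"
      using sum_squares_bound[of "norm a" "norm b"] by (simp add: power2_sum)
    finally show ?thesis .
  qed
  then show "AE x in M. (norm (f x + g x))\<^sup>2 \<le> 2 * (norm (f x))\<^sup>2 + 2 * (norm (g x))\<^sup>2"
    by auto
qed (use assms in \<open>auto simp: sq_integrable_def\<close>)

lemma sq_integrable_diff:
  assumes "sq_integrable M f" "sq_integrable M g"
  shows "sq_integrable M (\<lambda>x. f x - g x)"
  using sq_integrable_add[OF assms(1) sq_integrable_scaleR[OF assms(2), of "-1"]] by simp

lemma integrable_inner:
  fixes f g :: "'b \<Rightarrow> 'a::euclidean_space"
  assumes "sq_integrable M f" "sq_integrable M g"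
  shows "integrable M (\<lambda>x. f x \<bullet> g x)"
proof (rule Bochner_Integration.integrable_bound[where f = "\<lambda>x. (norm (f x))\<^sup>2 + (norm (g x))\<^sup>2"])
  show "AE x in M. norm (f x \<bullet> g x) \<le> norm ((norm (f x))\<^sup>2 + (norm (g x))\<^sup>2)"
  proof (rule AE_I2)
    fix x
    have "\<bar>f x \<bullet> g x\<bar> \<le> norm (f x) * norm (g x)" by (rule Cauchy_Schwarz_ineq2)
    also have "\<dots> \<le> (norm (f x))\<^sup>2 + (norm (g x))\<^sup>2"
      using sum_squares_bound[of "norm (f x)" "norm (g x)"]
        mult_nonneg_nonneg[OF norm_ge_zero norm_ge_zero, of "f x" "g x"] by linarith
    finally show "norm (f x \<bullet> g x) \<le> norm ((norm (f x))\<^sup>2 + (norm (g x))\<^sup>2)" by simp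
  qed
qed (use assms in \<open>auto simp: sq_integrable_def\<close>)

lemma norm2_add_power2:
  fixes f g :: "'b \<Rightarrow> 'a::euclidean_space"
  assumes "sq_integrable M f" "sq_integrable M g"
  shows "(norm2 M (\<lambda>x. f x + g x))\<^sup>2 = (norm2 M f)\<^sup>2 + 2 * (\<integral>x. f x \<bullet> g x \<partial>M) + (norm2 M g)\<^sup>2"
proof -
  have i: "integrable M (\<lambda>x. f x \<bullet> g x)" "integrable M (\<lambda>x. (norm (f x))\<^sup>2)"
    "integrable M (\<lambda>x. (norm (g x))\<^sup>2)"
    using assms integrable_inner by (auto simp: sq_integrable_def)
  have "(\<integral>x. (norm (f x + g x))\<^sup>2 \<partial>M)
      = (\<integral>x. (norm (f x))\<^sup>2 + 2 * (f x \<bullet> g x) + (norm (g x))\<^sup>2 \<partial>M)"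
    by (intro Bochner_Integration.integral_cong refl)
      (simp add: power2_norm_eq_inner inner_add inner_commute)
  also have "\<dots> = (\<integral>x. (norm (f x))\<^sup>2 \<partial>M) + 2 * (\<integral>x. f x \<bullet> g x \<partial>M) + (\<integral>x. (norm (g x))\<^sup>2 \<partial>M)"
    using i by simp
  finally show ?thesis by (simp add: norm2_power2)
qed

lemma norm2_scaleR: "norm2 M (\<lambda>x. c *\<^sub>R f x) = \<bar>c\<bar> * norm2 M f"
  by (simp add: norm2_def power_mult_distrib real_sqrt_mult)

lemma norm2_minus: "norm2 M (\<lambda>x. - f x) = norm2 M f"
  by (simp add: norm2_def)

lemma norm2_diff_commute: "norm2 M (\<lambda>x. f x - g x) = norm2 M (\<lambda>x. g x - f x)"
  by (simp add: norm2_def norm_minus_commute)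

lemma norm2_zero [simp]: "norm2 M (\<lambda>x. 0) = 0"
  by (simp add: norm2_def)

text \<open>Used in three ways: nonnegativity for every \<open>s\<close> gives the Cauchy-Schwarz
  inequality, the values 1 and -1 of \<open>s\<close> give the parallelogram identity, and small
  \<open>s\<close> gives the optimality condition of the Moreau minimizer.\<close>

lemma norm2_add_scaleR_power2:
  fixes f g :: "'b \<Rightarrow> 'a::euclidean_space"
  assumes "sq_integrable M f" "sq_integrable M g"
  shows "(norm2 M (\<lambda>x. f x + s *\<^sub>R g x))\<^sup>2
    = (norm2 M f)\<^sup>2 + 2 * s * (\<integral>x. f x \<bullet> g x \<partial>M) + s\<^sup>2 * (norm2 M g)\<^sup>2"
  using norm2_add_power2[OF assms(1) sq_integrable_scaleR[OF assms(2)], of s]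
  by (simp add: norm2_scaleR power_mult_distrib)

lemma norm2_Cauchy_Schwarz:
  fixes f g :: "'b \<Rightarrow> 'a::euclidean_space"
  assumes "sq_integrable M f" "sq_integrable M g"
  shows "\<bar>\<integral>x. f x \<bullet> g x \<partial>M\<bar> \<le> norm2 M f * norm2 M g"
proof -
  define a b c where "a = (norm2 M f)\<^sup>2" "b = (\<integral>x. f x \<bullet> g x \<partial>M)" "c = (norm2 M g)\<^sup>2"
  have q: "0 \<le> a + 2 * s * b + s\<^sup>2 * c" for s
    using norm2_add_scaleR_power2[OF assms, of s] zero_le_power2 a_b_c_def by metis
  have "b\<^sup>2 \<le> a * c"
  proof (cases "c = 0")
    case True
    have "b = 0"
    proof (rule ccontr)
      assume "b \<noteq> 0"
      \<comment> \<open>With \<open>c = 0\<close> the polynomial is affine in \<open>s\<close>, and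
        this choice of \<open>s\<close> gives it the value -1.\<close>
      then show False using q[of "- (a + 1) / (2 * b)"] True by (simp add: field_simps)
    qed
    then show ?thesis using True by simp
  next
    case False
    then have "0 < c" using a_b_c_def(3) by (simp add: less_le)
    \<comment> \<open>The point where the quadratic polynomial is minimal.\<close>
    then show ?thesis using q[of "- b / c"] by (simp add: field_simps power2_eq_square)
  qed
  then have "sqrt (b\<^sup>2) \<le> sqrt (a * c)" by (rule real_sqrt_le_mono)
  then show ?thesis by (simp add: a_b_c_def real_sqrt_mult)
qed

lemma norm2_triangle:
  fixes f g :: "'b \<Rightarrow> 'a::euclidean_space"
  assumes "sq_integrable M f" "sq_integrable M g"
  shows "norm2 M (\<lambda>x. f x + g x) \<le> norm2 M f + norm2 M g"
proof (rule power2_le_imp_le)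
  show "(norm2 M (\<lambda>x. f x + g x))\<^sup>2 \<le> (norm2 M f + norm2 M g)\<^sup>2"
    using norm2_add_power2[OF assms] norm2_Cauchy_Schwarz[OF assms] by (simp add: power2_sum)
qed simp

lemma norm2_triangle_diff:
  fixes f g h :: "'b \<Rightarrow> 'a::euclidean_space"
  assumes "sq_integrable M f" "sq_integrable M g" "sq_integrable M h"
  shows "norm2 M (\<lambda>x. f x - h x) \<le> norm2 M (\<lambda>x. f x - g x) + norm2 M (\<lambda>x. g x - h x)"
  using norm2_triangle[OF sq_integrable_diff[OF assms(1,2)] sq_integrable_diff[OF assms(2,3)]]
  by simp

lemma norm2_le_norm2_add_diff:
  fixes f g :: "'b \<Rightarrow> 'a::euclidean_space"
  assumes "sq_integrable M f" "sq_integrable M g"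
  shows "norm2 M f \<le> norm2 M g + norm2 M (\<lambda>x. f x - g x)"
  using norm2_triangle[OF assms(2) sq_integrable_diff[OF assms]] by simp

lemma sq_integrable_distr:
  assumes "T \<in> measurable M N" "f \<in> borel_measurable N"
  shows "sq_integrable (distr M N T) f \<longleftrightarrow> sq_integrable M (\<lambda>x. f (T x))"
proof -
  have "(\<lambda>x. f (T x)) \<in> borel_measurable M" using assms by measurable
  moreover have "(\<lambda>x. (norm (f x))\<^sup>2) \<in> borel_measurable N" using assms(2) by measurable
  ultimately show ?thesis
    using assms integrable_distr_eq[OF assms(1), of "\<lambda>x. (norm (f x))\<^sup>2"]
    by (simp add: sq_integrable_def)
qed

lemma norm2_distr:
  assumes "T \<in> measurable M N" "f \<in> borel_measurable N"
  shows "norm2 (distr M N T) f = norm2 M (\<lambda>x. f (T x))"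
proof -
  have "(\<lambda>x. (norm (f x))\<^sup>2) \<in> borel_measurable N" using assms(2) by measurable
  then show ?thesis
    unfolding norm2_def using assms by (simp add: integral_distr)
qed

lemma norm2_le_const:
  fixes f :: "'b \<Rightarrow> 'a::euclidean_space"
  assumes "prob_space M" "sq_integrable M f" "AE x in M. norm (f x) \<le> e" "0 \<le> e"
  shows "norm2 M f \<le> e"
proof (rule power2_le_imp_le)
  interpret prob_space M by fact
  have "(\<integral>x. (norm (f x))\<^sup>2 \<partial>M) \<le> (\<integral>x. e\<^sup>2 \<partial>M)"
    using assms by (intro integral_mono_AE) (auto simp: sq_integrable_def intro: power_mono)
  then show "(norm2 M f)\<^sup>2 \<le> e\<^sup>2" by (simp add: norm2_power2 prob_space)
qed fact

section \<open>Couplings and the triangle inequality\<close>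

lemma P2_iff:
  "\<mu> \<in> P2 \<longleftrightarrow> prob_space \<mu> \<and> sets \<mu> = sets borel \<and> sq_integrable \<mu> (\<lambda>x. x)"
proof (cases "sets \<mu> = sets borel")
  case True
  then have "(\<lambda>x. x) \<in> borel_measurable \<mu>" by (simp add: measurable_ident_sets)
  then show ?thesis using True by (simp add: P2_def sq_integrable_def)
qed (simp add: P2_def)

lemma distr_in_P2:
  fixes X :: "'b \<Rightarrow> 'a::euclidean_space"
  assumes "prob_space M" "sq_integrable M X"
  shows "distr M borel X \<in> P2"
  using assms
  by (auto simp: P2_iff sq_integrable_distr sq_integrable_measurable intro: prob_space.prob_space_distr)

lemma measurable_fst_snd_couplings:
  assumes "\<pi> \<in> couplings \<mu> \<nu>"
  shows "fst \<in> measurable \<pi> borel" "snd \<in> measurable \<pi> borel"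
proof -
  have s: "sets \<pi> = sets (borel \<Otimes>\<^sub>M borel)" using assms by (simp add: couplings_def)
  show "fst \<in> measurable \<pi> borel" "snd \<in> measurable \<pi> borel"
    by (simp_all add: measurable_cong_sets[OF s refl])
qed

lemma prob_space_coupling:
  assumes "\<pi> \<in> couplings \<mu> \<nu>" "prob_space \<mu>"
  shows "prob_space \<pi>"
proof (rule prob_space_distrD)
  show "fst \<in> measurable \<pi> borel" using measurable_fst_snd_couplings[OF assms(1)] by simp
  show "prob_space (distr \<pi> borel fst)" using assms by (simp add: couplings_def)
qed

lemma sq_integrable_coupling:
  assumes "\<pi> \<in> couplings \<mu> \<nu>" "\<mu> \<in> P2" "\<nu> \<in> P2"
  shows "sq_integrable \<pi> fst" "sq_integrable \<pi> snd"
proof -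
  have "sq_integrable (distr \<pi> borel fst) (\<lambda>x. x)" "sq_integrable (distr \<pi> borel snd) (\<lambda>x. x)"
    using assms by (auto simp: couplings_def P2_iff)
  then show "sq_integrable \<pi> fst" "sq_integrable \<pi> snd"
    using measurable_fst_snd_couplings[OF assms(1)] by (simp_all add: sq_integrable_distr)
qed

lemma couplings_nonempty:
  assumes "\<mu> \<in> P2" "\<nu> \<in> P2"
  shows "couplings \<mu> \<nu> \<noteq> {}"
proof -
  interpret \<mu>: prob_space \<mu> using assms by (simp add: P2_def)
  interpret \<nu>: prob_space \<nu> using assms by (simp add: P2_def)
  interpret pair_prob_space \<mu> \<nu> ..
  have s: "sets \<mu> = sets borel" "sets \<nu> = sets borel" using assms by (auto simp: P2_def)
  have "distr (\<mu> \<Otimes>\<^sub>M \<nu>) borel fst = \<mu>"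
    using \<nu>.distr_pair_fst[of \<mu>] distr_cong[OF refl s(1), of "\<mu> \<Otimes>\<^sub>M \<nu>" fst fst] by simp
  moreover have "distr (\<mu> \<Otimes>\<^sub>M \<nu>) borel snd = \<nu>"
  proof -
    have "distr (\<mu> \<Otimes>\<^sub>M \<nu>) \<nu> snd = distr (\<nu> \<Otimes>\<^sub>M \<mu>) \<nu> fst"
      by (subst distr_pair_swap) (simp add: distr_distr comp_def case_prod_beta)
    then show ?thesis
      using \<mu>.distr_pair_fst[of \<nu>] distr_cong[OF refl s(2), of "\<mu> \<Otimes>\<^sub>M \<nu>" snd snd] by simp
  qed
  ultimately have "\<mu> \<Otimes>\<^sub>M \<nu> \<in> couplings \<mu> \<nu>"
    using s by (simp add: couplings_def cong: sets_pair_measure_cong)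
  then show ?thesis by blast
qed

lemma W2_le_coupling:
  assumes "\<pi> \<in> couplings \<mu> \<nu>"
  shows "W2 \<mu> \<nu> \<le> norm2 \<pi> (\<lambda>p. fst p - snd p)"
  unfolding W2_def norm2_def dist_norm using assms
  by (intro real_sqrt_le_mono cINF_lower bdd_belowI[of _ 0]) auto

text \<open>The joint law of \<open>X\<close> and \<open>Y\<close> is a coupling of their laws. All
  upper bounds on \<open>W2\<close> below are obtained by choosing two random variables on a common
  space.\<close>

lemma W2_distr_le:
  fixes X Y :: "'b \<Rightarrow> 'a::euclidean_space"
  assumes [measurable]: "X \<in> borel_measurable M" "Y \<in> borel_measurable M"
  shows "W2 (distr M borel X) (distr M borel Y) \<le> norm2 M (\<lambda>\<omega>. X \<omega> - Y \<omega>)"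
proof -
  let ?\<pi> = "distr M (borel \<Otimes>\<^sub>M borel) (\<lambda>\<omega>. (X \<omega>, Y \<omega>))"
  have "?\<pi> \<in> couplings (distr M borel X) (distr M borel Y)"
    by (simp add: couplings_def distr_distr comp_def)
  from W2_le_coupling[OF this] show ?thesis
    by (simp add: norm2_distr)
qed

text \<open>The strict bound leaves room for a coupling whose cost is only close to the
  infimum.\<close>

lemma W2_less_coupling:
  assumes "\<mu> \<in> P2" "\<nu> \<in> P2" "W2 \<mu> \<nu> < r"
  obtains \<pi> where "\<pi> \<in> couplings \<mu> \<nu>" "norm2 \<pi> (\<lambda>p. fst p - snd p) < r"
proof -
  let ?c = "\<lambda>\<pi>. \<integral>p. (dist (fst p) (snd p))\<^sup>2 \<partial>\<pi>"
  \<comment> \<open>The real square root is extended to negative arguments as an odd function, so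
    \<open>0 < r\<close> follows only once the sign of the infimum is known.\<close>
  have "0 \<le> (INF \<pi>\<in>couplings \<mu> \<nu>. ?c \<pi>)"
    using couplings_nonempty[OF assms(1,2)] by (intro cINF_greatest) auto
  then have "0 < r" using assms(3) unfolding W2_def
    by (meson le_less_trans real_sqrt_ge_zero)
  then have "(INF \<pi>\<in>couplings \<mu> \<nu>. ?c \<pi>) < r\<^sup>2"
    using assms(3) unfolding W2_def by (metis real_less_lsqrt real_sqrt_less_iff real_sqrt_unique less_imp_le)
  then obtain \<pi> where "\<pi> \<in> couplings \<mu> \<nu>" "?c \<pi> < r\<^sup>2"
    using cInf_lessD[of "?c ` couplings \<mu> \<nu>" "r\<^sup>2"] couplings_nonempty[OF assms(1,2)] by blast
  then show ?thesis using \<open>0 < r\<close>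
    by (intro that[of \<pi>]) (auto simp: norm2_def dist_norm intro: real_less_lsqrt)
qed

lemma W2_self:
  assumes "\<mu> \<in> P2"
  shows "W2 \<mu> \<mu> \<le> 0"
proof -
  have "sets \<mu> = sets borel" using assms by (simp add: P2_def)
  then have "(\<lambda>x. x) \<in> borel_measurable \<mu>" "distr \<mu> borel (\<lambda>x. x) = \<mu>"
    by (simp_all add: measurable_ident_sets distr_id2)
  then show ?thesis using W2_distr_le[of "\<lambda>x. x" \<mu> "\<lambda>x. x"] by simp
qed

section \<open>Approximate gluing of couplings and the strict triangle inequality for
  \<open>W2\<close>\<close>

lemma countable_partition_small_diameter:
  fixes e :: real
  assumes "0 < e"
  obtains i :: "'a::euclidean_space \<Rightarrow> nat" where
    "i \<in> measurable borel (count_space UNIV)" "\<And>x y. i x = i y \<Longrightarrow> norm (x - y) \<le> e"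
proof -
  obtain D :: "'a set" where D: "countable D" "\<And>X. open X \<Longrightarrow> X \<noteq> {} \<Longrightarrow> \<exists>d\<in>D. d \<in> X"
    using countable_dense_setE by blast
  define d where "d = from_nat_into D"
  \<comment> \<open>The index of the first point of the dense sequence within \<open>e / 2\<close>.
    Points with the same index are close to the same point, hence to each other.\<close>
  define i where "i x = (LEAST n. dist (d n) x < e / 2)" for x
  have ex: "dist (d (i x)) x < e / 2" for x
  proof -
    obtain y where y: "y \<in> D" "y \<in> ball x (e / 2)"
      using D(2)[of "ball x (e / 2)"] assms by auto
    then obtain n where "d n = y" using D(1) d_def by (metis from_nat_into_to_nat_on)
    then have "dist (d n) x < e / 2" using y by (simp add: dist_commute)
    then show ?thesis unfolding i_def by (rule LeastI)
  qed
  have "i \<in> measurable borel (count_space UNIV)"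
    unfolding i_def by measurable
  moreover have "norm (x - y) \<le> e" if "i x = i y" for x y
    using ex[of x] ex[of y] that dist_triangle[of x y "d (i x)"]
    by (simp add: dist_norm[symmetric] dist_commute)
  ultimately show ?thesis using that by blast
qed

text \<open>
  Instead of disintegrating along the common marginal, the two couplings are glued independently
  of each other on each cell of a countable partition into cells of diameter at most \<open>e\<close>.
  The two copies of the middle point are then at most \<open>e\<close> apart.
\<close>

lemma approximate_gluing:
  fixes \<nu> :: "'a::euclidean_space measure"
  assumes \<pi>1: "\<pi>1 \<in> couplings \<mu> \<nu>" and \<pi>2: "\<pi>2 \<in> couplings \<nu> \<rho>"
    and \<nu>: "prob_space \<nu>" and e: "0 < e"
  obtains \<gamma> where
    "sets \<gamma> = sets (\<pi>1 \<Otimes>\<^sub>M \<pi>2)" "distr \<gamma> \<pi>1 fst = \<pi>1" "distr \<gamma> \<pi>2 snd = \<pi>2"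
    "AE p in \<gamma>. norm (snd (fst p) - fst (snd p)) \<le> e"
proof -
  obtain i :: "'a \<Rightarrow> nat" where i [measurable]: "i \<in> measurable borel (count_space UNIV)"
    and i_e: "\<And>x y. i x = i y \<Longrightarrow> norm (x - y) \<le> e"
    using countable_partition_small_diameter[OF e] by blast
  note [measurable] = measurable_fst_snd_couplings[OF \<pi>1] measurable_fst_snd_couplings[OF \<pi>2]
  interpret \<nu>: prob_space \<nu> by fact
  have d1: "distr \<pi>1 borel snd = \<nu>" and d2: "distr \<pi>2 borel fst = \<nu>"
    using \<pi>1 \<pi>2 by (auto simp: couplings_def)
  have s\<nu>: "sets \<nu> = sets borel" unfolding d1[symmetric] by simp
  interpret p1: prob_space \<pi>1
    by (rule prob_space_distrD[of snd _ borel]) (use d1 \<nu> in auto)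
  interpret p2: prob_space \<pi>2
    using prob_space_coupling[OF \<pi>2 \<nu>] .
  interpret P: pair_prob_space \<pi>1 \<pi>2 ..
  define a where "a n = emeasure \<nu> {y. i y = n}" for n
  \<comment> \<open>Density of the gluing with respect to the product measure. It forces both copies
    of the middle point into one cell and divides by the mass of that cell, so that inside a cell
    the two couplings are independent.\<close>
  define h :: "('a \<times> 'a) \<times> ('a \<times> 'a) \<Rightarrow> ennreal" where
    "h = (\<lambda>(p, q). if i (snd p) = i (fst q) then inverse (a (i (snd p))) else 0)"
  have cell: "{y. i y = n} \<in> sets borel" for n
    using measurable_sets[OF i, of "{n}"] by (simp add: vimage_def)
  have a1: "emeasure \<pi>1 {p \<in> space \<pi>1. i (snd p) = n} = a n" for n
    unfolding a_def d1[symmetric] using cell by (subst emeasure_distr) (auto intro!: arg_cong[of _ _ "emeasure \<pi>1"])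
  have a2: "emeasure \<pi>2 {q \<in> space \<pi>2. i (fst q) = n} = a n" for n
    unfolding a_def d2[symmetric] using cell by (subst emeasure_distr) (auto intro!: arg_cong[of _ _ "emeasure \<pi>2"])
  have fin: "a n \<noteq> \<infinity>" for n using \<nu>.emeasure_finite unfolding a_def by auto
  have h [measurable]: "h \<in> borel_measurable (\<pi>1 \<Otimes>\<^sub>M \<pi>2)"
  proof -
    have j: "(\<lambda>z. i (snd (fst z))) \<in> measurable (\<pi>1 \<Otimes>\<^sub>M \<pi>2) (count_space UNIV)"
      "(\<lambda>z. i (fst (snd z))) \<in> measurable (\<pi>1 \<Otimes>\<^sub>M \<pi>2) (count_space UNIV)"
      by measurable
    note [measurable] = j
    \<comment> \<open>Equality of the two indices is written as a countable union over their common
      value, which makes its measurability provable cell by cell.\<close>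
    have "{z \<in> space (\<pi>1 \<Otimes>\<^sub>M \<pi>2). \<exists>n. i (fst (snd z)) = n \<and> i (snd (fst z)) = n}
        \<in> sets (\<pi>1 \<Otimes>\<^sub>M \<pi>2)"
      by measurable
    moreover have "(\<lambda>z. inverse (a (i (snd (fst z))))) \<in> borel_measurable (\<pi>1 \<Otimes>\<^sub>M \<pi>2)"
      using measurable_compose[OF j(1), of "\<lambda>n. inverse (a n)" borel] by simp
    ultimately show ?thesis
      unfolding h_def case_prod_beta by (intro measurable_If) auto
  qed
  \<comment> \<open>On a cell of mass 0 the normalization \<open>inverse (a n)\<close> is
    \<infinity>. There are countably many cells, so almost no point of either coupling lies in such
    a cell.\<close>
  have AE_a: "AE p in \<pi>1. a (i (snd p)) \<noteq> 0" "AE q in \<pi>2. a (i (fst q)) \<noteq> 0"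
  proof -
    have "AE p in \<pi>1. i (snd p) \<noteq> n" if "a n = 0" for n
      using that a1[of n] by (intro AE_I'[of "{p \<in> space \<pi>1. i (snd p) = n}"]) auto
    then have "AE p in \<pi>1. a n = 0 \<longrightarrow> i (snd p) \<noteq> n" for n
      by (cases "a n = 0") auto
    then have "AE p in \<pi>1. \<forall>n. a n = 0 \<longrightarrow> i (snd p) \<noteq> n"
      unfolding AE_all_countable by blast
    then show "AE p in \<pi>1. a (i (snd p)) \<noteq> 0" by eventually_elim auto
    have "AE q in \<pi>2. i (fst q) \<noteq> n" if "a n = 0" for n
      using that a2[of n] by (intro AE_I'[of "{p \<in> space \<pi>2. i (fst p) = n}"]) auto
    then have "AE q in \<pi>2. a n = 0 \<longrightarrow> i (fst q) \<noteq> n" for n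
      by (cases "a n = 0") auto
    then have "AE q in \<pi>2. \<forall>n. a n = 0 \<longrightarrow> i (fst q) \<noteq> n"
      unfolding AE_all_countable by blast
    then show "AE q in \<pi>2. a (i (fst q)) \<noteq> 0" by eventually_elim auto
  qed
  have inv: "inverse (a n) * a n = 1" if "a n \<noteq> 0" for n
    using ennreal_divide_self[of "a n"] that fin[of n]
    by (simp add: divide_ennreal_def mult.commute less_top)
  \<comment> \<open>By Tonelli, inner integrals equal to 1 are what makes the marginals of the
    density measure equal to \<open>\<pi>1\<close> and \<open>\<pi>2\<close>.\<close>
  have m1: "(\<integral>\<^sup>+ q. h (p, q) \<partial>\<pi>2) = 1" if "a (i (snd p)) \<noteq> 0" for p
  proof -
    have "(\<integral>\<^sup>+ q. h (p, q) \<partial>\<pi>2)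
        = (\<integral>\<^sup>+ q. inverse (a (i (snd p))) * indicator {q \<in> space \<pi>2. i (fst q) = i (snd p)} q \<partial>\<pi>2)"
      by (intro nn_integral_cong) (auto simp: h_def indicator_def)
    also have "\<dots> = inverse (a (i (snd p))) * a (i (snd p))"
      by (subst nn_integral_cmult_indicator) (auto simp: a2)
    finally show ?thesis using inv[OF that] by simp
  qed
  have m2: "(\<integral>\<^sup>+ p. h (p, q) \<partial>\<pi>1) = 1" if "a (i (fst q)) \<noteq> 0" for q
  proof -
    have "(\<integral>\<^sup>+ p. h (p, q) \<partial>\<pi>1)
        = (\<integral>\<^sup>+ p. inverse (a (i (fst q))) * indicator {p \<in> space \<pi>1. i (snd p) = i (fst q)} p \<partial>\<pi>1)"
      by (intro nn_integral_cong) (auto simp: h_def indicator_def)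
    also have "\<dots> = inverse (a (i (fst q))) * a (i (fst q))"
      by (subst nn_integral_cmult_indicator) (auto simp: a1)
    finally show ?thesis using inv[OF that] by simp
  qed
  define \<gamma> where "\<gamma> = density (\<pi>1 \<Otimes>\<^sub>M \<pi>2) h"
  have [simp, measurable_cong]: "sets \<gamma> = sets (\<pi>1 \<Otimes>\<^sub>M \<pi>2)" by (simp add: \<gamma>_def)
  then have sp: "space \<gamma> = space \<pi>1 \<times> space \<pi>2"
    by (metis sets_eq_imp_space_eq space_pair_measure)
  have "distr \<gamma> \<pi>1 fst = \<pi>1"
  proof (rule measure_eqI)
    fix A assume "A \<in> sets (distr \<gamma> \<pi>1 fst)"
    then have A [measurable]: "A \<in> sets \<pi>1" by simp
    have "emeasure (distr \<gamma> \<pi>1 fst) A = (\<integral>\<^sup>+ z. h z * indicator (A \<times> space \<pi>2) z \<partial>(\<pi>1 \<Otimes>\<^sub>M \<pi>2))"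
      using sets.sets_into_space[OF A]
      by (subst emeasure_distr)
        (auto simp: \<gamma>_def emeasure_density space_pair_measure intro!: nn_integral_cong split: split_indicator)
    also have "\<dots> = (\<integral>\<^sup>+ p. \<integral>\<^sup>+ q. h (p, q) * indicator (A \<times> space \<pi>2) (p, q) \<partial>\<pi>2 \<partial>\<pi>1)"
      by (subst p2.nn_integral_fst[symmetric]) auto
    also have "\<dots> = (\<integral>\<^sup>+ p. indicator A p * (\<integral>\<^sup>+ q. h (p, q) \<partial>\<pi>2) \<partial>\<pi>1)"
      by (intro nn_integral_cong, subst nn_integral_cmult[symmetric])
        (auto intro!: nn_integral_cong split: split_indicator)
    also have "\<dots> = (\<integral>\<^sup>+ p. indicator A p \<partial>\<pi>1)"
      using AE_a(1) by (intro nn_integral_cong_AE) (auto simp: m1)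
    finally show "emeasure (distr \<gamma> \<pi>1 fst) A = emeasure \<pi>1 A" by simp
  qed simp
  moreover have "distr \<gamma> \<pi>2 snd = \<pi>2"
  proof (rule measure_eqI)
    fix A assume "A \<in> sets (distr \<gamma> \<pi>2 snd)"
    then have A [measurable]: "A \<in> sets \<pi>2" by simp
    have "emeasure (distr \<gamma> \<pi>2 snd) A = (\<integral>\<^sup>+ z. h z * indicator (space \<pi>1 \<times> A) z \<partial>(\<pi>1 \<Otimes>\<^sub>M \<pi>2))"
      using sets.sets_into_space[OF A]
      by (subst emeasure_distr)
        (auto simp: \<gamma>_def emeasure_density space_pair_measure intro!: nn_integral_cong split: split_indicator)
    also have "\<dots> = (\<integral>\<^sup>+ q. \<integral>\<^sup>+ p. h (p, q) * indicator (space \<pi>1 \<times> A) (p, q) \<partial>\<pi>1 \<partial>\<pi>2)"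
      by (subst P.nn_integral_snd[symmetric]) auto
    also have "\<dots> = (\<integral>\<^sup>+ q. indicator A q * (\<integral>\<^sup>+ p. h (p, q) \<partial>\<pi>1) \<partial>\<pi>2)"
      by (intro nn_integral_cong, subst nn_integral_cmult[symmetric])
        (auto intro!: nn_integral_cong split: split_indicator)
    also have "\<dots> = (\<integral>\<^sup>+ q. indicator A q \<partial>\<pi>2)"
      using AE_a(2) by (intro nn_integral_cong_AE) (auto simp: m2)
    finally show "emeasure (distr \<gamma> \<pi>2 snd) A = emeasure \<pi>2 A" by simp
  qed simp
  moreover have "AE p in \<gamma>. norm (snd (fst p) - fst (snd p)) \<le> e"
    unfolding \<gamma>_def AE_density[OF h]
    by (rule AE_I2) (auto simp: h_def split: if_splits intro: i_e)
  ultimately show ?thesis using that[of \<gamma>] by simp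
qed

text \<open>Through the gluing, the distance between the outer points splits into the two coupling
  costs and the gap between the two copies of the middle point. The slack in the strict assumptions
  absorbs that gap.\<close>

lemma W2_triangle_less:
  fixes \<nu> :: "'a::euclidean_space measure"
  assumes P: "\<mu> \<in> P2" "\<nu> \<in> P2" "\<rho> \<in> P2" and "W2 \<mu> \<nu> < r" "W2 \<nu> \<rho> < s"
  shows "W2 \<mu> \<rho> < r + s"
proof -
  obtain \<pi>1 where \<pi>1: "\<pi>1 \<in> couplings \<mu> \<nu>" and c1: "norm2 \<pi>1 (\<lambda>p. fst p - snd p) < r"
    using W2_less_coupling[OF P(1,2) assms(4)] .
  obtain \<pi>2 where \<pi>2: "\<pi>2 \<in> couplings \<nu> \<rho>" and c2: "norm2 \<pi>2 (\<lambda>p. fst p - snd p) < s"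
    using W2_less_coupling[OF P(2,3) assms(5)] .
  \<comment> \<open>Half of the total slack, so that adding \<open>e\<close> to the two costs still
    stays below \<open>r + s\<close>.\<close>
  define e where "e = (r + s - norm2 \<pi>1 (\<lambda>p. fst p - snd p) - norm2 \<pi>2 (\<lambda>p. fst p - snd p)) / 2"
  have e: "0 < e" using c1 c2 by (simp add: e_def)
  have ps: "prob_space \<mu>" "prob_space \<nu>" using P by (auto simp: P2_def)
  obtain \<gamma> where s\<gamma>: "sets \<gamma> = sets (\<pi>1 \<Otimes>\<^sub>M \<pi>2)"
    and d: "distr \<gamma> \<pi>1 fst = \<pi>1" "distr \<gamma> \<pi>2 snd = \<pi>2"
    and AE: "AE p in \<gamma>. norm (snd (fst p) - fst (snd p)) \<le> e"
    using approximate_gluing[OF \<pi>1 \<pi>2 ps(2) e] .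
  have f: "fst \<in> measurable \<gamma> \<pi>1" "snd \<in> measurable \<gamma> \<pi>2"
    by (simp_all add: measurable_cong_sets[OF s\<gamma> refl])
  note [measurable] = f measurable_fst_snd_couplings[OF \<pi>1] measurable_fst_snd_couplings[OF \<pi>2]
  have "prob_space (distr \<gamma> \<pi>1 fst)" unfolding d by (rule prob_space_coupling[OF \<pi>1 ps(1)])
  then have p\<gamma>: "prob_space \<gamma>" using prob_space_distrD[OF f(1)] by simp
  have sq: "sq_integrable \<gamma> (\<lambda>p. fst (fst p))" "sq_integrable \<gamma> (\<lambda>p. snd (fst p))"
    "sq_integrable \<gamma> (\<lambda>p. fst (snd p))" "sq_integrable \<gamma> (\<lambda>p. snd (snd p))"
    using sq_integrable_coupling[OF \<pi>1 P(1,2)] sq_integrable_coupling[OF \<pi>2 P(2,3)]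
    by (simp_all add: sq_integrable_distr[OF f(1), symmetric] sq_integrable_distr[OF f(2), symmetric] d)
  have "distr \<gamma> borel (\<lambda>p. fst (fst p)) = distr (distr \<gamma> \<pi>1 fst) borel fst"
    "distr \<gamma> borel (\<lambda>p. snd (snd p)) = distr (distr \<gamma> \<pi>2 snd) borel snd"
    by (simp_all add: distr_distr comp_def)
  then have "distr \<gamma> borel (\<lambda>p. fst (fst p)) = \<mu>" "distr \<gamma> borel (\<lambda>p. snd (snd p)) = \<rho>"
    using \<pi>1 \<pi>2 by (simp_all add: d couplings_def)
  then have "W2 \<mu> \<rho> \<le> norm2 \<gamma> (\<lambda>p. fst (fst p) - snd (snd p))"
    using W2_distr_le[of "\<lambda>p. fst (fst p)" \<gamma> "\<lambda>p. snd (snd p)"] by simp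
  also have "\<dots> \<le> norm2 \<gamma> (\<lambda>p. fst (fst p) - snd (fst p)) + (norm2 \<gamma> (\<lambda>p. snd (fst p) - fst (snd p))
      + norm2 \<gamma> (\<lambda>p. fst (snd p) - snd (snd p)))"
    using norm2_triangle_diff[OF sq(1,2,4)] norm2_triangle_diff[OF sq(2,3,4)] by simp
  also have "norm2 \<gamma> (\<lambda>p. fst (fst p) - snd (fst p)) = norm2 \<pi>1 (\<lambda>p. fst p - snd p)"
    using norm2_distr[OF f(1), of "\<lambda>p. fst p - snd p"] by (simp add: d)
  also have "norm2 \<gamma> (\<lambda>p. fst (snd p) - snd (snd p)) = norm2 \<pi>2 (\<lambda>p. fst p - snd p)"
    using norm2_distr[OF f(2), of "\<lambda>p. fst p - snd p"] by (simp add: d)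
  also have "norm2 \<gamma> (\<lambda>p. snd (fst p) - fst (snd p)) \<le> e"
    using e by (intro norm2_le_const[OF p\<gamma> sq_integrable_diff[OF sq(2,3)] AE]) simp
  finally show ?thesis using c1 c2 by (simp add: e_def field_simps)
qed

section \<open>Continuous maps of linear growth\<close>

lemma C1_I:
  assumes "continuous_on UNIV w" "\<And>x. norm (w x) \<le> C * (1 + norm x)"
  shows "w \<in> C1"
proof -
  have "norm (w x) / (1 + norm x) \<le> C" for x
    using assms(2)[of x] by (simp add: divide_le_eq add_pos_nonneg)
  then show ?thesis
    using assms(1) by (auto simp: C1_def intro!: bdd_aboveI[of _ C])
qed

lemma C1_growth:
  fixes w :: "'a::euclidean_space \<Rightarrow> 'a"
  assumes "w \<in> C1"
  obtains C where "0 \<le> C" "\<And>x. norm (w x) \<le> C * (1 + norm x)"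
proof -
  obtain C where C: "\<And>x. norm (w x) / (1 + norm x) \<le> C"
    using assms by (auto simp: C1_def bdd_above_def)
  have "norm (w x) \<le> C * (1 + norm x)" for x
    using C[of x] by (simp add: divide_le_eq add_pos_nonneg)
  moreover have "0 \<le> C"
    using C[of 0] norm_ge_zero[of "w 0"] by (simp del: norm_ge_zero)
  ultimately show ?thesis using that by blast
qed

lemma C1_continuous: "w \<in> C1 \<Longrightarrow> continuous_on UNIV w"
  by (simp add: C1_def)

lemma C1_measurable: "w \<in> C1 \<Longrightarrow> w \<in> borel_measurable borel"
  by (intro borel_measurable_continuous_onI C1_continuous)

lemma C1_add:
  assumes "w1 \<in> C1" "w2 \<in> C1"
  shows "(\<lambda>x. w1 x + w2 x) \<in> C1"
proof -
  obtain A where A: "0 \<le> A" "\<And>x. norm (w1 x) \<le> A * (1 + norm x)"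
    using C1_growth[OF assms(1)] by blast
  obtain B where B: "0 \<le> B" "\<And>x. norm (w2 x) \<le> B * (1 + norm x)"
    using C1_growth[OF assms(2)] by blast
  have "norm (w1 x + w2 x) \<le> (A + B) * (1 + norm x)" for x
    using norm_triangle_ineq[of "w1 x" "w2 x"] A(2)[of x] B(2)[of x] unfolding distrib_right[of A B] by linarith
  with continuous_on_add[OF C1_continuous[OF assms(1)] C1_continuous[OF assms(2)]]
  show ?thesis by (rule C1_I)
qed

lemma C1_scaleR:
  assumes "w \<in> C1"
  shows "(\<lambda>x. c *\<^sub>R w x) \<in> C1"
proof -
  obtain A where A: "0 \<le> A" "\<And>x. norm (w x) \<le> A * (1 + norm x)"
    using C1_growth[OF assms] by blast
  then have "norm (c *\<^sub>R w x) \<le> (\<bar>c\<bar> * A) * (1 + norm x)" for x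
    by (simp add: mult_left_mono mult.assoc)
  with continuous_on_scaleR[OF continuous_on_const C1_continuous[OF assms]]
  show ?thesis by (rule C1_I)
qed

lemma C1_diff:
  assumes "w1 \<in> C1" "w2 \<in> C1"
  shows "(\<lambda>x. w1 x - w2 x) \<in> C1"
  using C1_add[OF assms(1) C1_scaleR[OF assms(2), of "-1"]] by simp

lemma C1_zero: "(\<lambda>x. 0) \<in> C1"
  by (rule C1_I[of _ 0]) auto

text \<open>Stated for compositions because \<open>w\<close> will be evaluated at either coordinate
  of a coupling and at displaced points.\<close>

lemma C1_sq_integrable:
  fixes w :: "'a::euclidean_space \<Rightarrow> 'a"
  assumes "w \<in> C1" "prob_space M" "sq_integrable M X"
  shows "sq_integrable M (\<lambda>\<omega>. w (X \<omega>))"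
proof -
  interpret prob_space M by fact
  obtain C where C: "0 \<le> C" "\<And>x. norm (w x) \<le> C * (1 + norm x)"
    using C1_growth[OF assms(1)] by blast
  have [measurable]: "X \<in> borel_measurable M" "w \<in> borel_measurable borel"
    using assms C1_measurable by (auto simp: sq_integrable_def)
  show ?thesis
  proof (rule sq_integrable_bound)
    show "integrable M (\<lambda>\<omega>. C\<^sup>2 * (2 + 2 * (norm (X \<omega>))\<^sup>2))"
      using assms(3) by (auto simp: sq_integrable_def)
    have "(norm (w x))\<^sup>2 \<le> C\<^sup>2 * (2 + 2 * (norm x)\<^sup>2)" for x
    proof -
      have "(norm (w x))\<^sup>2 \<le> (C * (1 + norm x))\<^sup>2"
        using C(2) by (intro power_mono) auto
      also have "\<dots> \<le> C\<^sup>2 * (2 + 2 * (norm x)\<^sup>2)"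
        unfolding power_mult_distrib using sum_squares_bound[of 1 "norm x"]
        by (intro mult_left_mono) (auto simp: power2_sum)
      finally show ?thesis .
    qed
    then show "AE \<omega> in M. (norm (w (X \<omega>)))\<^sup>2 \<le> C\<^sup>2 * (2 + 2 * (norm (X \<omega>))\<^sup>2)"
      by auto
  qed measurable
qed

lemma C1_sq_integrable_P2:
  assumes "w \<in> C1" "\<mu> \<in> P2"
  shows "sq_integrable \<mu> w"
  using C1_sq_integrable[OF assms(1), of \<mu> "\<lambda>x. x"] assms(2) by (simp add: P2_iff)

section \<open>Continuity of composition with a continuous map of linear growth\<close>

lemma tail_integral_small:
  fixes h :: "'a::real_normed_vector \<Rightarrow> real"
  assumes h: "integrable \<mu> h" and s: "sets \<mu> = sets borel" and e: "0 < e"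
  obtains R where "0 < R" "(\<integral>x. indicator {x. R < norm x} x * h x \<partial>\<mu>) < e"
proof -
  have [measurable_cong]: "sets \<mu> = sets borel" by fact
  have [measurable]: "h \<in> borel_measurable \<mu>" using h by simp
  have "(\<lambda>n. \<integral>x. indicator {x. real n < norm x} x * h x \<partial>\<mu>) \<longlonglongrightarrow> (\<integral>x. 0 \<partial>\<mu>)"
  proof (rule integral_dominated_convergence[where w = "\<lambda>x. norm (h x)"])
    have "(\<lambda>n. indicator {x. real n < norm x} x * h x) \<longlonglongrightarrow> 0" for x
    proof (rule tendsto_eventually)
      obtain N where "norm x < real N" using reals_Archimedean2 by blast
      then show "\<forall>\<^sub>F n in sequentially. indicator {x. real n < norm x} x * h x = 0"
        unfolding eventually_sequentially by (intro exI[of _ N]) (auto split: split_indicator)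
    qed
    then show "AE x in \<mu>. (\<lambda>n. indicator {x. real n < norm x} x * h x) \<longlonglongrightarrow> 0" by auto
    show "AE x in \<mu>. norm (indicator {x. real n < norm x} x * h x) \<le> norm (h x)" for n
      by (auto split: split_indicator)
  qed (use h in auto)
  then have "\<forall>\<^sub>F n in sequentially. (\<integral>x. indicator {x. real n < norm x} x * h x \<partial>\<mu>) < e"
    using e by (intro order_tendstoD(2)) auto
  then obtain N where "\<forall>n\<ge>N. (\<integral>x. indicator {x. real n < norm x} x * h x \<partial>\<mu>) < e"
    unfolding eventually_sequentially by blast
  \<comment> \<open>The successor guarantees a positive radius even when \<open>N\<close> is
    0.\<close>
  then show ?thesis using that[of "real (Suc N)"] by (metis le_SucI order_refl of_nat_0_less_iff zero_less_Suc)
qed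

text \<open>
  Inside a large ball uniform continuity controls the increment of \<open>w\<close>, except when \<open>y\<close> is far
  from \<open>x\<close>; then linear growth does. Outside, \<open>h\<close> absorbs it.
\<close>

lemma C1_increment_bound:
  fixes w :: "'a::euclidean_space \<Rightarrow> 'a"
  assumes w: "w \<in> C1" and \<mu>: "\<mu> \<in> P2" and e: "0 < e"
  obtains h K where "0 \<le> K" "integrable \<mu> h" "(\<integral>x. h x \<partial>\<mu>) < e"
    "\<And>x y. (norm (w y - w x))\<^sup>2 \<le> e + h x + K * (norm (x - y))\<^sup>2"
proof -
  interpret prob_space \<mu> using \<mu> by (simp add: P2_def)
  have s [measurable_cong]: "sets \<mu> = sets borel" using \<mu> by (simp add: P2_def)
  obtain C where C: "0 \<le> C" "\<And>x. norm (w x) \<le> C * (1 + norm x)"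
    using C1_growth[OF w] by blast
  \<comment> \<open>The part of the crude growth bound \<open>far\<close> that depends on
    \<open>x\<close> alone. Its tail beyond radius \<open>R\<close> becomes
    \<open>h\<close>.\<close>
  define k where "k x = 2 * C\<^sup>2 * (2 + 2 * norm x)\<^sup>2" for x :: 'a
  have "integrable \<mu> k"
  proof (rule Bochner_Integration.integrable_bound)
    show "integrable \<mu> (\<lambda>x. 2 * C\<^sup>2 * (8 + 8 * (norm x)\<^sup>2))"
      using \<mu> by (auto simp: P2_def)
    have "(2 + 2 * r)\<^sup>2 \<le> 8 + 8 * r\<^sup>2" for r :: real
      using sum_squares_bound[of 1 r] by (simp add: power2_sum power_mult_distrib)
    then have "k x \<le> 2 * C\<^sup>2 * (8 + 8 * (norm x)\<^sup>2)" for x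
      unfolding k_def by (intro mult_left_mono) auto
    then show "AE x in \<mu>. norm (k x) \<le> norm (2 * C\<^sup>2 * (8 + 8 * (norm x)\<^sup>2))"
      by (auto simp: k_def abs_mult)
  qed (unfold k_def[abs_def], measurable)
  from tail_integral_small[OF this s e] obtain R where
    R: "0 < R" "(\<integral>x. indicator {x. R < norm x} x * k x \<partial>\<mu>) < e" .
  define h where "h x = indicator {x. R < norm x} x * k x" for x
  have "integrable \<mu> h"
    unfolding h_def using \<open>integrable \<mu> k\<close> by (intro integrable_mult_indicator[where 'b = real, simplified]) measurable
  have far: "(norm (w y - w x))\<^sup>2 \<le> k x + 2 * C\<^sup>2 * (norm (x - y))\<^sup>2" for x y
  proof -
    have "norm y \<le> norm x + norm (x - y)" by (metis norm_minus_commute norm_triangle_sub)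
    then have "norm (w y) \<le> C * (1 + norm x + norm (x - y))"
      using C(2)[of y] C(1) by (smt (verit) mult_left_mono)
    then have "norm (w y - w x) \<le> C * ((2 + 2 * norm x) + norm (x - y))"
      using C(2)[of x] norm_triangle_ineq4[of "w y" "w x"] by (simp add: algebra_simps)
    then have "(norm (w y - w x))\<^sup>2 \<le> (C * ((2 + 2 * norm x) + norm (x - y)))\<^sup>2"
      by (intro power_mono) auto
    also have "\<dots> \<le> C\<^sup>2 * (2 * (2 + 2 * norm x)\<^sup>2 + 2 * (norm (x - y))\<^sup>2)"
      unfolding power_mult_distrib
      using sum_squares_bound[of "2 + 2 * norm x" "norm (x - y)"]
      by (intro mult_left_mono) (auto simp: power2_sum[of "2 + 2 * norm x"])
    finally show ?thesis by (simp add: k_def algebra_simps)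
  qed
  \<comment> \<open>The margin 1 matches \<open>d \<le> 1\<close> below: a point closer than
    \<open>d\<close> to some point of the ball of radius \<open>R\<close> stays in the larger
    ball.\<close>
  have "uniformly_continuous_on (cball 0 (R + 1)) w"
    by (intro compact_uniformly_continuous continuous_on_subset[OF C1_continuous[OF w]]) auto
  then obtain d' where d': "0 < d'" "\<And>x y. x \<in> cball 0 (R + 1) \<Longrightarrow> y \<in> cball 0 (R + 1) \<Longrightarrow>
      dist y x < d' \<Longrightarrow> dist (w y) (w x) < sqrt e"
    unfolding uniformly_continuous_on_def using e real_sqrt_gt_zero by metis
  define d where "d = min d' 1"
  have d: "0 < d" "d \<le> 1" "d \<le> d'" using d'(1) by (auto simp: d_def)
  \<comment> \<open>The first summand is the growth coefficient of \<open>far\<close>. The second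
    pays for \<open>k x\<close> when \<open>x\<close> lies in the ball but \<open>y\<close> is at
    distance at least \<open>d\<close>: then \<open>k x\<close> is at most its value at radius
    \<open>R\<close>, and the squared distance divided by the square of \<open>d\<close> is at least
    1.\<close>
  define K where "K = 2 * C\<^sup>2 + 2 * C\<^sup>2 * (2 + 2 * R)\<^sup>2 / d\<^sup>2"
  have K: "2 * C\<^sup>2 \<le> K" by (simp add: K_def)
  have "(norm (w y - w x))\<^sup>2 \<le> e + h x + K * (norm (x - y))\<^sup>2" for x y
  proof (cases "R < norm x")
    case True
    have "2 * C\<^sup>2 * (norm (x - y))\<^sup>2 \<le> K * (norm (x - y))\<^sup>2"
      using K by (intro mult_right_mono) auto
    then show ?thesis using far[of y x] True e by (simp add: h_def)
  next
    case False
    then have h0: "h x = 0" by (simp add: h_def)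
    have K0: "0 \<le> K" using K by (smt (verit) zero_le_power2)
    show ?thesis
    proof (cases "norm (x - y) < d")
      case True
      have "norm y \<le> norm x + norm (x - y)" by (metis norm_minus_commute norm_triangle_sub)
      then have "dist (w y) (w x) < sqrt e"
        using True False d by (intro d'(2)) (auto simp: dist_norm norm_minus_commute)
      then have "(norm (w y - w x))\<^sup>2 \<le> (sqrt e)\<^sup>2"
        by (intro power_mono) (auto simp: dist_norm)
      then show ?thesis using e h0 K0 by (simp add: add_increasing2)
    next
      case False
      have "d\<^sup>2 \<le> (norm (x - y))\<^sup>2" using False d by (intro power_mono) auto
      then have "1 \<le> (norm (x - y))\<^sup>2 / d\<^sup>2" using d by simp
      then have "2 * C\<^sup>2 * (2 + 2 * R)\<^sup>2 * 1 \<le> 2 * C\<^sup>2 * (2 + 2 * R)\<^sup>2 * ((norm (x - y))\<^sup>2 / d\<^sup>2)"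
        by (intro mult_left_mono) auto
      moreover have "k x \<le> 2 * C\<^sup>2 * (2 + 2 * R)\<^sup>2"
        unfolding k_def using \<open>\<not> R < norm x\<close> by (intro mult_left_mono power_mono) auto
      ultimately have "k x \<le> 2 * C\<^sup>2 * (2 + 2 * R)\<^sup>2 / d\<^sup>2 * (norm (x - y))\<^sup>2" by simp
      then show ?thesis using far[of y x] e h0 by (simp add: K_def algebra_simps)
    qed
  qed
  moreover have "0 \<le> K" using K by (smt (verit) zero_le_power2)
  ultimately show ?thesis
    using that[of K h] \<open>integrable \<mu> h\<close> R(2) by (simp add: h_def)
qed

text \<open>Integrating the pointwise increment bound leaves three terms, and only the law of
  \<open>X\<close> enters the one with \<open>h\<close>. Hence \<open>d\<close> serves all
  probability spaces and all perturbations \<open>Y\<close> at once.\<close>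

lemma C1_composition_continuous:
  fixes w :: "'a::euclidean_space \<Rightarrow> 'a"
  assumes w: "w \<in> C1" and \<mu>: "\<mu> \<in> P2" and e: "0 < e"
  obtains d where "0 < d" "\<And>(M :: 'b measure) X Y. prob_space M \<Longrightarrow> sq_integrable M X \<Longrightarrow>
    sq_integrable M Y \<Longrightarrow> distr M borel X = \<mu> \<Longrightarrow> norm2 M (\<lambda>\<omega>. X \<omega> - Y \<omega>) < d \<Longrightarrow>
    norm2 M (\<lambda>\<omega>. w (Y \<omega>) - w (X \<omega>)) < e"
proof -
  have "0 < e\<^sup>2 / 4" using e by simp
  from C1_increment_bound[OF w \<mu> this] obtain h K where K: "0 \<le> K" and h: "integrable \<mu> h"
    "(\<integral>x. h x \<partial>\<mu>) < e\<^sup>2 / 4"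
    and b: "\<And>x y. (norm (w y - w x))\<^sup>2 \<le> e\<^sup>2 / 4 + h x + K * (norm (x - y))\<^sup>2" by metis
  \<comment> \<open>Chosen so that the quadratic term contributes at most a quarter of the square of
    \<open>e\<close>. Writing \<open>K + 1\<close> avoids a division by zero.\<close>
  define d where "d = e / (2 * sqrt (K + 1))"
  have d: "0 < d" using e K by (simp add: d_def)
  have "K * d\<^sup>2 = (K / (K + 1)) * (e\<^sup>2 / 4)"
    using K by (simp add: d_def power_divide power_mult_distrib)
  also have "\<dots> \<le> 1 * (e\<^sup>2 / 4)" using K by (intro mult_right_mono) auto
  finally have Kd: "K * d\<^sup>2 \<le> e\<^sup>2 / 4" by simp
  have "norm2 M (\<lambda>\<omega>. w (Y \<omega>) - w (X \<omega>)) < e"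
    if M: "prob_space M" and X: "sq_integrable M X" and Y: "sq_integrable M Y"
      and D: "distr M borel X = \<mu>" and XY: "norm2 M (\<lambda>\<omega>. X \<omega> - Y \<omega>) < d"
    for M :: "'b measure" and X Y
  proof (rule power2_less_imp_less)
    interpret prob_space M by fact
    have [measurable]: "X \<in> borel_measurable M" using X by (simp add: sq_integrable_def)
    have hm [measurable]: "h \<in> borel_measurable borel"
      using borel_measurable_integrable[OF h(1)] \<mu> by (simp add: P2_def cong: measurable_cong_sets)
    have hX: "integrable M (\<lambda>\<omega>. h (X \<omega>))" "(\<integral>\<omega>. h (X \<omega>) \<partial>M) = (\<integral>x. h x \<partial>\<mu>)"
      using h(1) by (simp_all add: D[symmetric] integrable_distr_eq integral_distr)
    have d1: "sq_integrable M (\<lambda>\<omega>. X \<omega> - Y \<omega>)" using X Y by (rule sq_integrable_diff)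
    have d2: "sq_integrable M (\<lambda>\<omega>. w (Y \<omega>) - w (X \<omega>))"
      using C1_sq_integrable[OF w M] X Y by (intro sq_integrable_diff)
    have i: "integrable M (\<lambda>\<omega>. (norm (X \<omega> - Y \<omega>))\<^sup>2)"
      "integrable M (\<lambda>\<omega>. (norm (w (Y \<omega>) - w (X \<omega>)))\<^sup>2)"
      using d1 d2 by (auto simp: sq_integrable_def)
    have "(norm2 M (\<lambda>\<omega>. w (Y \<omega>) - w (X \<omega>)))\<^sup>2
        \<le> (\<integral>\<omega>. e\<^sup>2 / 4 + h (X \<omega>) + K * (norm (X \<omega> - Y \<omega>))\<^sup>2 \<partial>M)"
      unfolding norm2_power2 using i hX b by (intro integral_mono) auto
    also have "\<dots> = e\<^sup>2 / 4 + (\<integral>x. h x \<partial>\<mu>) + K * (norm2 M (\<lambda>\<omega>. X \<omega> - Y \<omega>))\<^sup>2"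
      unfolding norm2_power2 using i hX by (simp add: prob_space)
    also have "K * (norm2 M (\<lambda>\<omega>. X \<omega> - Y \<omega>))\<^sup>2 \<le> K * d\<^sup>2"
      using K XY by (intro mult_left_mono power_mono) auto
    finally show "(norm2 M (\<lambda>\<omega>. w (Y \<omega>) - w (X \<omega>)))\<^sup>2 < e\<^sup>2"
      using h(2) Kd \<open>0 < e\<^sup>2 / 4\<close> by linarith
  qed (use e in simp)
  then show ?thesis using that d by blast
qed

section \<open>Density of the continuous maps of linear growth\<close>

lemma finite_measure_borel_regular:
  fixes \<mu> :: "'a::{second_countable_topology, complete_space} measure"
  assumes "finite_measure \<mu>" and s: "sets \<mu> = sets borel" and A: "A \<in> sets borel" and e: "0 < e"
  obtains K U where "compact K" "open U" "K \<subseteq> A" "A \<subseteq> U" "measure \<mu> (U - K) < e"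
proof -
  interpret finite_measure \<mu> by fact
  have fin: "emeasure \<mu> (space \<mu>) \<noteq> \<infinity>" by simp
  obtain K where K: "K \<subseteq> A" "compact K" "measure \<mu> A - e / 2 < measure \<mu> K"
  proof (cases "measure \<mu> A - e / 2 < 0")
    \<comment> \<open>\<open>ennreal\<close> truncates a negative threshold to 0, which no compact
      subset of a null set exceeds. Here the empty set already satisfies the real
      inequality.\<close>
    case True
    then show ?thesis using that[of "{}"] by simp
  next
    case False
    have "ennreal (measure \<mu> A - e / 2) < emeasure \<mu> A"
      using e False by (simp add: emeasure_eq_measure ennreal_less_iff)
    then have "\<exists>K\<in>{K. K \<subseteq> A \<and> compact K}. ennreal (measure \<mu> A - e / 2) < emeasure \<mu> K"
      unfolding inner_regular[OF s fin A] less_SUP_iff .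
    then show ?thesis
      using that False by (auto simp: emeasure_eq_measure ennreal_less_iff)
  qed
  have "emeasure \<mu> A < ennreal (measure \<mu> A + e / 2)"
    using e by (simp add: emeasure_eq_measure ennreal_less_iff)
  then have "\<exists>U\<in>{U. A \<subseteq> U \<and> open U}. emeasure \<mu> U < ennreal (measure \<mu> A + e / 2)"
    unfolding outer_regular[OF s fin A] INF_less_iff .
  then obtain U where U: "A \<subseteq> U" "open U" "measure \<mu> U < measure \<mu> A + e / 2"
    by (auto simp: emeasure_eq_measure ennreal_less_iff)
  have "measure \<mu> (U - K) = measure \<mu> U - measure \<mu> K"
    using U K s by (intro finite_measure_Diff) (auto simp: compact_imp_closed)
  then show ?thesis using that K U by simp
qed

text \<open>Packages approximability as a property that is stable under finite sums, so that simple
  functions reduce to indicators.\<close>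

definition C1_approximable :: "'a::euclidean_space measure \<Rightarrow> ('a \<Rightarrow> 'a) \<Rightarrow> bool" where
  "C1_approximable \<mu> f \<longleftrightarrow>
     sq_integrable \<mu> f \<and> (\<forall>e>0. \<exists>w\<in>C1. norm2 \<mu> (\<lambda>x. f x - w x) < e)"

lemma C1_approximable_add:
  assumes \<mu>: "\<mu> \<in> P2" and "C1_approximable \<mu> f" "C1_approximable \<mu> g"
  shows "C1_approximable \<mu> (\<lambda>x. f x + g x)"
  unfolding C1_approximable_def
proof (intro conjI allI impI)
  have sq: "sq_integrable \<mu> f" "sq_integrable \<mu> g"
    using assms by (auto simp: C1_approximable_def)
  then show "sq_integrable \<mu> (\<lambda>x. f x + g x)" by (rule sq_integrable_add)
  fix e :: real assume "0 < e"
  then obtain v w where v: "v \<in> C1" "norm2 \<mu> (\<lambda>x. f x - v x) < e / 2"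
    and w: "w \<in> C1" "norm2 \<mu> (\<lambda>x. g x - w x) < e / 2"
    using assms unfolding C1_approximable_def by (meson half_gt_zero)
  have "norm2 \<mu> (\<lambda>x. (f x - v x) + (g x - w x)) \<le> norm2 \<mu> (\<lambda>x. f x - v x) + norm2 \<mu> (\<lambda>x. g x - w x)"
    using sq v w C1_sq_integrable_P2[OF _ \<mu>] by (intro norm2_triangle sq_integrable_diff) auto
  then have "norm2 \<mu> (\<lambda>x. (f x + g x) - (v x + w x)) < e"
    using v w by (simp add: algebra_simps)
  then show "\<exists>w\<in>C1. norm2 \<mu> (\<lambda>x. (f x + g x) - w x) < e"
    by (intro bexI[OF _ C1_add[OF v(1) w(1)]])
qed

lemma C1_approximable_zero: "C1_approximable \<mu> (\<lambda>x. 0)"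
  unfolding C1_approximable_def using C1_zero
  by (auto simp: sq_integrable_def intro!: bexI[of _ "\<lambda>x. 0"])

lemma C1_approximable_sum:
  assumes "\<mu> \<in> P2" "finite I" "\<And>i. i \<in> I \<Longrightarrow> C1_approximable \<mu> (f i)"
  shows "C1_approximable \<mu> (\<lambda>x. \<Sum>i\<in>I. f i x)"
  using assms(2,3)
  by (induction I rule: finite_induct)
    (auto simp: C1_approximable_zero C1_approximable_add[OF assms(1)])

text \<open>Regularity squeezes \<open>A\<close> between a compact \<open>K\<close> and an open
  \<open>U\<close> with \<open>U - K\<close> of small mass. A Urysohn function for this pair differs
  from the indicator only on \<open>U - K\<close>, and there by at most 1.\<close>

lemma C1_approximable_indicator:
  fixes c :: "'a::euclidean_space"
  assumes \<mu>: "\<mu> \<in> P2" and A: "A \<in> sets borel"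
  shows "C1_approximable \<mu> (\<lambda>x. indicator A x *\<^sub>R c)"
  unfolding C1_approximable_def
proof (intro conjI allI impI)
  interpret prob_space \<mu> using \<mu> by (simp add: P2_def)
  have s [measurable_cong]: "sets \<mu> = sets borel" using \<mu> by (simp add: P2_def)
  have A' [measurable]: "A \<in> sets \<mu>" using A s by simp
  have "(norm (indicator A x *\<^sub>R c))\<^sup>2 \<le> (norm c)\<^sup>2" for x
    by (auto split: split_indicator)
  then show sqA: "sq_integrable \<mu> (\<lambda>x. indicator A x *\<^sub>R c)"
    by (intro sq_integrable_bound[where h = "\<lambda>x. (norm c)\<^sup>2"]) auto
  fix e :: real assume e: "0 < e"
  \<comment> \<open>Makes the squared error smaller than the square of \<open>e\<close>. The summand
    1 covers \<open>c = 0\<close>.\<close>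
  define d where "d = e\<^sup>2 / (1 + (norm c)\<^sup>2)"
  have d: "0 < d" using e by (auto simp: d_def intro!: divide_pos_pos add_pos_nonneg)
  obtain K U where KU: "compact K" "open U" "K \<subseteq> A" "A \<subseteq> U" "measure \<mu> (U - K) < d"
    using finite_measure_borel_regular[OF finite_measure_axioms s A d] .
  obtain g :: "'a \<Rightarrow> real" where g: "continuous_on UNIV g" "\<And>x. g x \<in> closed_segment 1 0"
    "\<And>x. x \<in> K \<Longrightarrow> g x = 1" "\<And>x. x \<in> - U \<Longrightarrow> g x = 0"
    by (rule Urysohn[of K "- U" 1 0]) (use KU in \<open>auto simp: compact_imp_closed closed_Compl\<close>)
  have g01: "0 \<le> g x" "g x \<le> 1" for x using g(2)[of x] by (auto simp: closed_segment_eq_real_ivl)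
  define w where "w x = g x *\<^sub>R c" for x
  have w: "w \<in> C1"
  proof (rule C1_I)
    show "continuous_on UNIV w"
      unfolding w_def by (intro continuous_on_scaleR g(1) continuous_on_const)
    have "norm (w x) \<le> norm c" for x
      using g01[of x] mult_right_mono[of "g x" 1 "norm c"] by (simp add: w_def)
    also have "norm c \<le> norm c * (1 + norm x)" for x :: 'a
      by (simp add: algebra_simps)
    finally show "norm (w x) \<le> norm c * (1 + norm x)" for x .
  qed
  have KU' [measurable]: "U - K \<in> sets \<mu>" using KU s by (auto simp: compact_imp_closed)
  have b: "(norm (indicator A x *\<^sub>R c - w x))\<^sup>2 \<le> (norm c)\<^sup>2 * indicator (U - K) x" for x
  proof (cases "x \<in> U - K")
    case True
    have "\<bar>indicator A x - g x\<bar> \<le> 1" using g01[of x] by (auto split: split_indicator)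
    then have "\<bar>indicator A x - g x\<bar> * norm c \<le> 1 * norm c" by (intro mult_right_mono) auto
    then have "norm (indicator A x *\<^sub>R c - w x) \<le> norm c"
      by (simp add: w_def scaleR_diff_left[symmetric])
    then show ?thesis using True by (simp add: power_mono)
  next
    case False
    then have "indicator A x = g x" using KU(3,4) g(3,4)[of x] by (auto split: split_indicator)
    then show ?thesis by (simp add: w_def)
  qed
  have iU: "integrable \<mu> (\<lambda>x. (norm c)\<^sup>2 * indicator (U - K) x :: real)"
    using KU' by (intro integrable_mult_right integrable_real_indicator) (auto simp: less_top[symmetric])
  have sqd: "sq_integrable \<mu> (\<lambda>x. indicator A x *\<^sub>R c - w x)"
    using sqA C1_sq_integrable_P2[OF w \<mu>] by (rule sq_integrable_diff)
  have "norm2 \<mu> (\<lambda>x. indicator A x *\<^sub>R c - w x) < e"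
  proof (rule power2_less_imp_less)
    have "(norm2 \<mu> (\<lambda>x. indicator A x *\<^sub>R c - w x))\<^sup>2 \<le> (\<integral>x. (norm c)\<^sup>2 * indicator (U - K) x \<partial>\<mu>)"
      unfolding norm2_power2 using sqd b iU
      by (intro integral_mono) (auto simp only: sq_integrable_def)
    also have "\<dots> = (norm c)\<^sup>2 * measure \<mu> (U - K)" using KU' sets.sets_into_space by simp
    also have "\<dots> \<le> (norm c)\<^sup>2 * d" using KU(5) by (intro mult_left_mono) auto
    also have "\<dots> < (1 + (norm c)\<^sup>2) * d" using d by simp
    also have "\<dots> = e\<^sup>2" using add_pos_nonneg[of 1 "(norm c)\<^sup>2"] by (simp add: d_def)
    finally show "(norm2 \<mu> (\<lambda>x. indicator A x *\<^sub>R c - w x))\<^sup>2 < e\<^sup>2" .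
  qed (use e in simp)
  then show "\<exists>w\<in>C1. norm2 \<mu> (\<lambda>x. indicator A x *\<^sub>R c - w x) < e" using w by blast
qed

text \<open>A simple function is a finite sum of indicators times vectors and is thus already
  approximable; dominated convergence passes from simple functions to \<open>f\<close>.\<close>

lemma C1_dense:
  fixes f :: "'a::euclidean_space \<Rightarrow> 'a"
  assumes \<mu>: "\<mu> \<in> P2" and f: "sq_integrable \<mu> f" and e: "0 < e"
  obtains w where "w \<in> C1" "norm2 \<mu> (\<lambda>x. f x - w x) < e"
proof -
  interpret prob_space \<mu> using \<mu> by (simp add: P2_def)
  have s: "sets \<mu> = sets borel" using \<mu> by (simp add: P2_def)
  then have sp: "space \<mu> = UNIV" by (metis sets_eq_imp_space_eq space_borel)
  have fm [measurable]: "f \<in> borel_measurable \<mu>" using f by (simp add: sq_integrable_def)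
  obtain F where F: "\<And>i. simple_function \<mu> (F i)" "\<And>x. x \<in> space \<mu> \<Longrightarrow> (\<lambda>i. F i x) \<longlonglongrightarrow> f x"
    "\<And>i x. x \<in> space \<mu> \<Longrightarrow> dist (F i x) 0 \<le> 2 * dist (f x) 0"
    using borel_measurable_implies_sequence_metric[OF fm, of 0] by metis
  have Fm [measurable]: "F i \<in> borel_measurable \<mu>" for i
    using F(1) by (rule borel_measurable_simple_function)
  have fb: "norm (F i x) \<le> 2 * norm (f x)" for i x using F(3)[of x i] sp by simp
  \<comment> \<open>The 9 is the square of 1 + 2: the simple functions are bounded by twice
    \<open>norm (f x)\<close>, so their distance to \<open>f x\<close> is at most three times
    it.\<close>
  have i4: "integrable \<mu> (\<lambda>x. 9 * (norm (f x))\<^sup>2)" using f by (simp add: sq_integrable_def)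
  have FA: "C1_approximable \<mu> (F i)" for i
  proof -
    have "finite (range (F i))" using F(1)[of i] sp by (simp add: simple_function_def)
    moreover have "F i -` {y} \<in> sets borel" for y
      using measurable_sets[OF Fm, of "{y}" i] sp s by simp
    ultimately have "C1_approximable \<mu> (\<lambda>x. \<Sum>y\<in>range (F i). indicator (F i -` {y}) x *\<^sub>R y)"
      by (intro C1_approximable_sum[OF \<mu>] C1_approximable_indicator[OF \<mu>])
    also have "(\<lambda>x. \<Sum>y\<in>range (F i). indicator (F i -` {y}) x *\<^sub>R y) = F i"
    proof
      fix x
      have "(\<Sum>y\<in>range (F i). indicator (F i -` {y}) x *\<^sub>R y) = (\<Sum>y\<in>range (F i). if F i x = y then y else 0)"
        by (intro sum.cong) (auto split: split_indicator)
      then show "(\<Sum>y\<in>range (F i). indicator (F i -` {y}) x *\<^sub>R y) = F i x"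
        using \<open>finite (range (F i))\<close> by simp
    qed
    finally show ?thesis .
  qed
  have "(\<lambda>i. \<integral>x. (norm (f x - F i x))\<^sup>2 \<partial>\<mu>) \<longlonglongrightarrow> (\<integral>x. 0 \<partial>\<mu>)"
  proof (rule integral_dominated_convergence[where w = "\<lambda>x. 9 * (norm (f x))\<^sup>2"])
    have "(\<lambda>i. (norm (f x - F i x))\<^sup>2) \<longlonglongrightarrow> (norm (f x - f x))\<^sup>2" for x
      using F(2)[of x] sp by (intro tendsto_intros) auto
    then show "AE x in \<mu>. (\<lambda>i. (norm (f x - F i x))\<^sup>2) \<longlonglongrightarrow> 0" by simp
    have "(norm (f x - F i x))\<^sup>2 \<le> (3 * norm (f x))\<^sup>2" for i x
      using norm_triangle_ineq4[of "f x" "F i x"] fb[of i x] by (intro power_mono) auto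
    then show "AE x in \<mu>. norm ((norm (f x - F i x))\<^sup>2) \<le> 9 * (norm (f x))\<^sup>2" for i
      by (simp add: power_mult_distrib)
  qed (use i4 in auto)
  then have "\<forall>\<^sub>F i in sequentially. (\<integral>x. (norm (f x - F i x))\<^sup>2 \<partial>\<mu>) < (e / 2)\<^sup>2"
    using e by (intro order_tendstoD(2)) auto
  then obtain i where i: "(\<integral>x. (norm (f x - F i x))\<^sup>2 \<partial>\<mu>) < (e / 2)\<^sup>2"
    unfolding eventually_sequentially by blast
  have n1: "norm2 \<mu> (\<lambda>x. f x - F i x) < e / 2"
    by (rule power2_less_imp_less) (use i e in \<open>auto simp: norm2_power2\<close>)
  obtain w where w: "w \<in> C1" "norm2 \<mu> (\<lambda>x. F i x - w x) < e / 2"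
    using FA[of i] e unfolding C1_approximable_def by (meson half_gt_zero)
  have "norm2 \<mu> (\<lambda>x. f x - w x) \<le> norm2 \<mu> (\<lambda>x. f x - F i x) + norm2 \<mu> (\<lambda>x. F i x - w x)"
    using f FA[of i] C1_sq_integrable_P2[OF w(1) \<mu>]
    by (intro norm2_triangle_diff) (auto simp: C1_approximable_def)
  then show ?thesis using n1 w that by fastforce
qed

section \<open>Completeness\<close>

text \<open>Fatou's lemma, which yields the square integrability of the limit together with the
  bound.\<close>

lemma norm2_limit_le:
  fixes f :: "nat \<Rightarrow> 'b \<Rightarrow> 'a::euclidean_space"
  assumes f: "\<And>n. sq_integrable M (f n)" and g [measurable]: "g \<in> borel_measurable M"
    and lim: "AE x in M. (\<lambda>n. f n x) \<longlonglongrightarrow> g x"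
    and bound: "\<forall>\<^sub>F n in sequentially. norm2 M (f n) \<le> C"
  shows "sq_integrable M g" "norm2 M g \<le> C"
proof -
  have [measurable]: "f n \<in> borel_measurable M" for n using f by (simp add: sq_integrable_def)
  obtain N where "\<forall>n\<ge>N. norm2 M (f n) \<le> C" using bound unfolding eventually_sequentially by blast
  then have C0: "0 \<le> C" by (meson norm2_nonneg order_refl order_trans)
  have i: "(\<integral>\<^sup>+x. ennreal ((norm (f n x))\<^sup>2) \<partial>M) = ennreal ((norm2 M (f n))\<^sup>2)" for n
    using f[of n] unfolding norm2_power2 by (intro nn_integral_eq_integral) (auto simp: sq_integrable_def)
  have "(\<integral>\<^sup>+x. ennreal ((norm (g x))\<^sup>2) \<partial>M) = (\<integral>\<^sup>+x. liminf (\<lambda>n. ennreal ((norm (f n x))\<^sup>2)) \<partial>M)"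
  proof (rule nn_integral_cong_AE)
    show "AE x in M. ennreal ((norm (g x))\<^sup>2) = liminf (\<lambda>n. ennreal ((norm (f n x))\<^sup>2))"
      using lim
    proof eventually_elim
      case (elim x)
      then have "(\<lambda>n. ennreal ((norm (f n x))\<^sup>2)) \<longlonglongrightarrow> ennreal ((norm (g x))\<^sup>2)"
        by (intro tendsto_intros) auto
      then show ?case by (intro lim_imp_Liminf[symmetric]) auto
    qed
  qed
  also have "\<dots> \<le> liminf (\<lambda>n. \<integral>\<^sup>+x. ennreal ((norm (f n x))\<^sup>2) \<partial>M)"
    by (rule nn_integral_liminf) measurable
  also have "\<dots> \<le> liminf (\<lambda>n. ennreal (C\<^sup>2))"
    unfolding i by (intro Liminf_mono eventually_mono[OF bound] ennreal_leI power_mono) auto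
  finally have l: "(\<integral>\<^sup>+x. ennreal ((norm (g x))\<^sup>2) \<partial>M) \<le> ennreal (C\<^sup>2)"
    by (simp add: Liminf_const)
  then have "integrable M (\<lambda>x. (norm (g x))\<^sup>2)"
    by (intro integrableI_nonneg) (auto simp: le_less_trans[OF l])
  then show sq: "sq_integrable M g" by (simp add: sq_integrable_def)
  then have "ennreal ((norm2 M g)\<^sup>2) \<le> ennreal (C\<^sup>2)"
    using l unfolding norm2_power2
    by (subst nn_integral_eq_integral[symmetric]) (auto simp: sq_integrable_def)
  then have "(norm2 M g)\<^sup>2 \<le> C\<^sup>2" by simp
  then show "norm2 M g \<le> C" using C0 by (rule power2_le_imp_le)
qed

text \<open>The geometric rate makes the sequence itself converge almost everywhere, with no passage
  to a subsequence. The minimizing sequence of the Moreau argument is built to have this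
  rate.\<close>

lemma norm2_complete:
  fixes f :: "nat \<Rightarrow> 'b \<Rightarrow> 'a::euclidean_space"
  assumes f: "\<And>n. sq_integrable M (f n)"
    and cauchy: "\<And>n k. n \<le> k \<Longrightarrow> norm2 M (\<lambda>x. f n x - f k x) \<le> (1 / 2) ^ n"
  obtains g where "sq_integrable M g" "(\<lambda>n. norm2 M (\<lambda>x. g x - f n x)) \<longlonglongrightarrow> 0"
proof -
  have [measurable]: "f n \<in> borel_measurable M" for n using f by (simp add: sq_integrable_def)
  define d where "d n x = f n x - f (Suc n) x" for n x
  have d: "sq_integrable M (d n)" for n unfolding d_def using f by (intro sq_integrable_diff)
  have [measurable]: "d n \<in> borel_measurable M" for n using d by (simp add: sq_integrable_def)
  \<comment> \<open>The weight \<open>2 ^ n\<close> makes the square summability of \<open>d n x\<close> imply summability.\<close>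
  have "(\<integral>\<^sup>+x. (\<Sum>n. ennreal (2 ^ n * (norm (d n x))\<^sup>2)) \<partial>M)
      = (\<Sum>n. \<integral>\<^sup>+x. ennreal (2 ^ n * (norm (d n x))\<^sup>2) \<partial>M)"
    by (rule nn_integral_suminf) measurable
  also have "\<dots> \<le> (\<Sum>n. ennreal ((1 / 2) ^ n))"
  proof (intro suminf_le allI)
    fix n
    have "(\<integral>\<^sup>+x. ennreal (2 ^ n * (norm (d n x))\<^sup>2) \<partial>M) = ennreal (\<integral>x. 2 ^ n * (norm (d n x))\<^sup>2 \<partial>M)"
      using d[of n] by (intro nn_integral_eq_integral) (auto simp: sq_integrable_def)
    also have "(\<integral>x. 2 ^ n * (norm (d n x))\<^sup>2 \<partial>M) = 2 ^ n * (norm2 M (d n))\<^sup>2"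
      by (simp add: norm2_power2)
    also have "\<dots> \<le> 2 ^ n * ((1 / 2) ^ n)\<^sup>2"
      using cauchy[of n "Suc n"] unfolding d_def by (intro mult_left_mono power_mono) auto
    also have "\<dots> = (1 / 2) ^ n"
      by (simp add: power2_eq_square power_mult_distrib[symmetric] flip: mult.assoc)
    finally show "(\<integral>\<^sup>+x. ennreal (2 ^ n * (norm (d n x))\<^sup>2) \<partial>M) \<le> ennreal ((1 / 2) ^ n)"
      by (simp add: ennreal_leI)
  qed auto
  also have "\<dots> = ennreal (\<Sum>n. (1 / 2) ^ n)"
    by (rule suminf_ennreal2) (auto intro!: summable_geometric)
  finally have "(\<integral>\<^sup>+x. (\<Sum>n. ennreal (2 ^ n * (norm (d n x))\<^sup>2)) \<partial>M) \<noteq> \<infinity>"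
    by (auto simp: top_unique)
  then have AE: "AE x in M. (\<Sum>n. ennreal (2 ^ n * (norm (d n x))\<^sup>2)) \<noteq> \<infinity>"
    by (intro nn_integral_PInf_AE) auto
  have conv: "convergent (\<lambda>n. f n x)" if "(\<Sum>n. ennreal (2 ^ n * (norm (d n x))\<^sup>2)) \<noteq> \<infinity>" for x
  proof -
    have s1: "summable (\<lambda>n. 2 ^ n * (norm (d n x))\<^sup>2)"
      using that by (intro summable_suminf_not_top) auto
    have "norm (d n x) \<le> 2 ^ n * (norm (d n x))\<^sup>2 + (1 / 2) ^ n" for n
    proof -
      \<comment> \<open>Two times a product is at most the sum of the squares. The two roots
        multiply to 1, so the weight cancels and leaves a summable remainder.\<close>
      have "2 * norm (d n x) = 2 * (sqrt (2 ^ n) * norm (d n x)) * sqrt ((1 / 2) ^ n)"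
        by (simp add: real_sqrt_mult[symmetric] power_mult_distrib[symmetric])
      also have "\<dots> \<le> (sqrt (2 ^ n) * norm (d n x))\<^sup>2 + (sqrt ((1 / 2) ^ n))\<^sup>2"
        by (rule sum_squares_bound)
      also have "\<dots> = 2 ^ n * (norm (d n x))\<^sup>2 + (1 / 2) ^ n"
        by (simp add: power_mult_distrib)
      finally show ?thesis using norm_ge_zero[of "d n x"] by linarith
    qed
    moreover have "summable (\<lambda>n. 2 ^ n * (norm (d n x))\<^sup>2 + (1 / 2) ^ n)"
      using s1 by (intro summable_add) (auto intro!: summable_geometric)
    ultimately have "summable (\<lambda>n. d n x)"
      by (rule summable_comparison_test'[where N = 0, rotated])
    then have "(\<lambda>n. \<Sum>i<n. d i x) \<longlonglongrightarrow> (\<Sum>i. d i x)" by (rule summable_LIMSEQ)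
    then have "(\<lambda>n. f 0 x - (\<Sum>i<n. d i x)) \<longlonglongrightarrow> f 0 x - (\<Sum>i. d i x)" by (intro tendsto_intros)
    moreover have "f 0 x - (\<Sum>i<n. d i x) = f n x" for n
      by (induction n) (auto simp: d_def algebra_simps)
    ultimately show ?thesis by (auto simp: convergent_def)
  qed
  \<comment> \<open>Where the sequence diverges, \<open>lim\<close> has an unspecified value; this
    happens only on a null set.\<close>
  define g where "g x = lim (\<lambda>n. f n x)" for x
  have gm [measurable]: "g \<in> borel_measurable M" unfolding g_def by measurable
  have lim: "AE x in M. (\<lambda>n. f n x) \<longlonglongrightarrow> g x"
    using AE unfolding g_def convergent_LIMSEQ_iff[symmetric] by eventually_elim (rule conv)
  have b: "norm2 M (\<lambda>x. g x - f n x) \<le> (1 / 2) ^ n" "sq_integrable M (\<lambda>x. g x - f n x)" for n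
  proof -
    \<comment> \<open>With \<open>n\<close> fixed and \<open>k\<close> going to infinity, the Cauchy
      bound becomes a bound on the distance to the limit.\<close>
    have "AE x in M. (\<lambda>k. f k x - f n x) \<longlonglongrightarrow> g x - f n x"
      using lim by eventually_elim (intro tendsto_intros)
    moreover have "\<forall>\<^sub>F k in sequentially. norm2 M (\<lambda>x. f k x - f n x) \<le> (1 / 2) ^ n"
      unfolding eventually_sequentially using cauchy[of n] by (auto simp: norm2_diff_commute[of M _ "f n"])
    ultimately show "norm2 M (\<lambda>x. g x - f n x) \<le> (1 / 2) ^ n" "sq_integrable M (\<lambda>x. g x - f n x)"
      using norm2_limit_le[of M "\<lambda>k x. f k x - f n x" "\<lambda>x. g x - f n x" "(1 / 2) ^ n"]
        sq_integrable_diff[OF f f] by auto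
  qed
  have "sq_integrable M g" using sq_integrable_add[OF b(2)[of 0] f[of 0]] by simp
  moreover have "(\<lambda>n. norm2 M (\<lambda>x. g x - f n x)) \<longlonglongrightarrow> 0"
    by (rule tendsto_sandwich[OF _ _ tendsto_const LIMSEQ_power_zero[of "1 / 2 :: real"]])
      (use b(1) in auto)
  ultimately show ?thesis by (rule that)
qed

section \<open>Sublinear functionals on square-integrable maps\<close>

lemma norm2_parallelogram:
  fixes f g :: "'b \<Rightarrow> 'a::euclidean_space"
  assumes "sq_integrable M f" "sq_integrable M g"
  shows "(norm2 M (\<lambda>x. f x + g x))\<^sup>2 + (norm2 M (\<lambda>x. f x - g x))\<^sup>2
    = 2 * (norm2 M f)\<^sup>2 + 2 * (norm2 M g)\<^sup>2"
  using norm2_add_scaleR_power2[OF assms, of 1] norm2_add_scaleR_power2[OF assms, of "-1"] by simp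

text \<open>The parallelogram identity centred at \<open>b\<close>. The negative last term is the
  uniform convexity that forces minimizing sequences to be Cauchy.\<close>

lemma norm2_midpoint_power2:
  fixes u v b :: "'b \<Rightarrow> 'a::euclidean_space"
  assumes "sq_integrable M u" "sq_integrable M v" "sq_integrable M b"
  shows "(norm2 M (\<lambda>x. (1 / 2) *\<^sub>R (u x + v x) - b x))\<^sup>2
    = (norm2 M (\<lambda>x. u x - b x))\<^sup>2 / 2 + (norm2 M (\<lambda>x. v x - b x))\<^sup>2 / 2 - (norm2 M (\<lambda>x. u x - v x))\<^sup>2 / 4"
proof -
  have "(\<lambda>x. (1 / 2) *\<^sub>R (u x + v x) - b x) = (\<lambda>x. (1 / 2) *\<^sub>R ((u x - b x) + (v x - b x)))"
    by (auto simp: algebra_simps scaleR_add_left[symmetric])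
  then have half: "norm2 M (\<lambda>x. (1 / 2) *\<^sub>R (u x + v x) - b x) = norm2 M (\<lambda>x. (u x - b x) + (v x - b x)) / 2"
    by (simp add: norm2_scaleR del: scaleR_add_right)
  show ?thesis
    unfolding half power_divide
    using norm2_parallelogram[OF sq_integrable_diff[OF assms(1,3)] sq_integrable_diff[OF assms(2,3)]]
    by simp
qed

text \<open>Divide by \<open>s\<close> and let \<open>s\<close> tend to 0. This extracts a
  first-order condition from an inequality with a quadratic error.\<close>

lemma le_of_le_add_small:
  fixes a b c :: real
  assumes "\<And>s. 0 < s \<Longrightarrow> s < 1 \<Longrightarrow> s * a \<le> s * b + s\<^sup>2 * c"
  shows "a \<le> b"
proof -
  have "((\<lambda>s. b + s * c) \<longlongrightarrow> b + 0 * c) (at_right 0)"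
    by (intro tendsto_intros)
  moreover have "\<forall>\<^sub>F s in at_right 0. a \<le> b + s * c"
    unfolding eventually_at_right_field
  proof (intro exI[of _ 1] conjI allI impI)
    fix s :: real assume "0 < s" "s < 1"
    then have "s * a \<le> s * (b + s * c)"
      using assms[of s] by (simp add: power2_eq_square algebra_simps)
    then show "a \<le> b + s * c" using \<open>0 < s\<close> by simp
  qed simp
  ultimately show ?thesis
    by (intro tendsto_lowerbound[where f = "\<lambda>s. b + s * c"]) auto
qed

text \<open>Isolates what the extended derivative satisfies, so that nonemptiness of the
  subdifferential and the support formula become convex analysis without Wasserstein
  geometry.\<close>

locale sublinear_lipschitz_functional =
  fixes M :: "'b measure" and E :: "('b \<Rightarrow> 'a::euclidean_space) \<Rightarrow> real" and L :: real
  assumes L_nonneg: "0 \<le> L"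
    and lipschitz: "sq_integrable M f \<Longrightarrow> sq_integrable M g \<Longrightarrow>
      \<bar>E f - E g\<bar> \<le> L * norm2 M (\<lambda>x. f x - g x)"
    and subadditive: "sq_integrable M f \<Longrightarrow> sq_integrable M g \<Longrightarrow> E (\<lambda>x. f x + g x) \<le> E f + E g"
    and homogeneous: "sq_integrable M f \<Longrightarrow> 0 \<le> c \<Longrightarrow> E (\<lambda>x. c *\<^sub>R f x) = c * E f"
begin

definition subgradient :: "('b \<Rightarrow> 'a) \<Rightarrow> bool" where
  "subgradient \<Xi> \<longleftrightarrow> sq_integrable M \<Xi> \<and> (\<forall>w. sq_integrable M w \<longrightarrow> (\<integral>x. \<Xi> x \<bullet> w x \<partial>M) \<le> E w)"

lemma abs_le: "sq_integrable M f \<Longrightarrow> \<bar>E f\<bar> \<le> L * norm2 M f"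
  using lipschitz[of f "\<lambda>x. 0 *\<^sub>R f x"] homogeneous[of f 0] sq_integrable_scaleR[of M f 0] by simp

text \<open>Testing \<open>\<Xi>\<close> against itself bounds the square of its norm by
  \<open>L\<close> times its norm.\<close>

lemma subgradient_norm_le:
  assumes "subgradient \<Xi>"
  shows "norm2 M \<Xi> \<le> L"
proof (cases "norm2 M \<Xi> = 0")
  case False
  have sq: "sq_integrable M \<Xi>" using assms by (simp add: subgradient_def)
  have "(norm2 M \<Xi>)\<^sup>2 = (\<integral>x. \<Xi> x \<bullet> \<Xi> x \<partial>M)" by (simp add: norm2_power2 power2_norm_eq_inner)
  also have "\<dots> \<le> E \<Xi>" using assms by (simp add: subgradient_def)
  also have "\<dots> \<le> L * norm2 M \<Xi>" using abs_le[OF sq] by simp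
  finally show ?thesis using False norm2_nonneg[of M \<Xi>] by (simp add: power2_eq_square)
qed (simp add: L_nonneg)

text \<open>
  Existence comes from the minimization of a Moreau envelope: the minimizer exists by the
  parallelogram identity and completeness, and its optimality condition exhibits a subgradient.
  Neither the Hahn-Banach theorem nor the Riesz representation theorem is needed.
\<close>

context
  fixes b :: "'b \<Rightarrow> 'a" and a :: real
  assumes b: "sq_integrable M b" and a: "0 < a"
begin

text \<open>The objective whose infimum over \<open>v\<close> is the Moreau envelope of
  \<open>E\<close> at \<open>b\<close>. A larger \<open>a\<close> ties the minimizer more closely to
  \<open>b\<close>.\<close>

definition envelope :: "('b \<Rightarrow> 'a) \<Rightarrow> real" where
  "envelope v = E v + a * (norm2 M (\<lambda>x. v x - b x))\<^sup>2"

lemma envelope_bounded_below: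
  assumes v: "sq_integrable M v"
  shows "- L * norm2 M b - L\<^sup>2 / (4 * a) \<le> envelope v"
proof -
  define s where "s = norm2 M (\<lambda>x. v x - b x)"
  have "norm2 M v \<le> norm2 M b + s" unfolding s_def by (rule norm2_le_norm2_add_diff[OF v b])
  then have "L * norm2 M v \<le> L * (norm2 M b + s)" using L_nonneg by (rule mult_left_mono)
  then have "- L * norm2 M b - L * s \<le> E v" using abs_le[OF v] by (simp add: algebra_simps)
  \<comment> \<open>Completing the square: the quadratic penalty dominates the linear decrease that
    the Lipschitz bound allows.\<close>
  moreover have "0 \<le> a * (s - L / (2 * a))\<^sup>2" using a by simp
  then have "- (L\<^sup>2 / (4 * a)) \<le> a * s\<^sup>2 - L * s"
    using a by (simp add: power2_diff power_divide power_mult_distrib algebra_simps)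
      (simp add: field_simps power2_eq_square)
  ultimately show ?thesis by (simp add: envelope_def s_def)
qed

text \<open>Sublinearity makes \<open>E\<close> midpoint convex, and the penalty contributes the
  strong convexity.\<close>

lemma envelope_midpoint:
  assumes u: "sq_integrable M u" and v: "sq_integrable M v"
  shows "envelope (\<lambda>x. (1 / 2) *\<^sub>R (u x + v x))
    \<le> envelope u / 2 + envelope v / 2 - a / 4 * (norm2 M (\<lambda>x. u x - v x))\<^sup>2"
proof -
  have "E (\<lambda>x. (1 / 2) *\<^sub>R (u x + v x)) \<le> E u / 2 + E v / 2"
    using homogeneous[OF sq_integrable_add[OF u v], of "1 / 2"] subadditive[OF u v] by simp
  then show ?thesis
    unfolding envelope_def norm2_midpoint_power2[OF u v b]
    by (simp add: algebra_simps add_divide_distrib del: scaleR_add_right)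
qed

lemma envelope_minimizer:
  obtains v where "sq_integrable M v" "\<And>w. sq_integrable M w \<Longrightarrow> envelope v \<le> envelope w"
proof -
  define m where "m = (INF v\<in>{v. sq_integrable M v}. envelope v)"
  have bdd: "bdd_below (envelope ` {v. sq_integrable M v})"
    using envelope_bounded_below by (intro bdd_belowI) auto
  have ne: "envelope ` {v. sq_integrable M v} \<noteq> {}" using b by blast
  have m: "m \<le> envelope w" if "sq_integrable M w" for w
    unfolding m_def using that by (intro cINF_lower[OF bdd]) simp
  \<comment> \<open>With this error level, midpoint convexity puts all later terms of the minimizing
    sequence within \<open>(1 / 2) ^ n\<close> of the \<open>n\<close>-th one, the rate that
    \<open>norm2_complete\<close> asks for.\<close>
  define \<eta> where "\<eta> n = a / 4 * ((1 / 2) ^ n)\<^sup>2" for n :: nat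
  have \<eta>: "0 < \<eta> n" "n \<le> k \<Longrightarrow> \<eta> k \<le> \<eta> n" for n k
    unfolding \<eta>_def using a by (auto intro!: mult_left_mono power_mono power_decreasing)
  have "\<exists>v. sq_integrable M v \<and> envelope v < m + \<eta> n" for n
    using cInf_lessD[OF ne, of "m + \<eta> n"] \<eta>(1)[of n] unfolding m_def by auto
  then obtain v where v: "\<And>n. sq_integrable M (v n)" "\<And>n. envelope (v n) < m + \<eta> n" by metis
  have "norm2 M (\<lambda>x. v n x - v k x) \<le> (1 / 2) ^ n" if "n \<le> k" for n k
  proof (rule power2_le_imp_le)
    have "m \<le> envelope (v n) / 2 + envelope (v k) / 2 - a / 4 * (norm2 M (\<lambda>x. v n x - v k x))\<^sup>2"
      using m[OF sq_integrable_scaleR[OF sq_integrable_add[OF v(1)[of n] v(1)[of k]]], of "1 / 2"]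
        envelope_midpoint[OF v(1)[of n] v(1)[of k]] by linarith
    then have "a / 4 * (norm2 M (\<lambda>x. v n x - v k x))\<^sup>2 \<le> \<eta> n"
      using v(2)[of n] v(2)[of k] \<eta>(2)[OF that] by argo
    then show "(norm2 M (\<lambda>x. v n x - v k x))\<^sup>2 \<le> ((1 / 2) ^ n)\<^sup>2"
      unfolding \<eta>_def using a by (subst (asm) mult_le_cancel_left_pos) auto
  qed simp
  from norm2_complete[of M v, OF v(1) this] obtain g where
    g: "sq_integrable M g" "(\<lambda>n. norm2 M (\<lambda>x. g x - v n x)) \<longlonglongrightarrow> 0" by blast
  have "(\<lambda>n. E (v n)) \<longlonglongrightarrow> E g"
  proof (rule metric_LIMSEQ_I)
    fix e :: real assume "0 < e"
    have "(\<lambda>n. L * norm2 M (\<lambda>x. g x - v n x)) \<longlonglongrightarrow> L * 0" by (intro tendsto_intros g(2))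
    from LIMSEQ_D[OF this \<open>0 < e\<close>] obtain N where N: "\<And>n. N \<le> n \<Longrightarrow> \<bar>L * norm2 M (\<lambda>x. g x - v n x)\<bar> < e"
      by auto
    have "dist (E (v n)) (E g) < e" if "N \<le> n" for n
      using lipschitz[OF g(1) v(1)[of n]] N[OF that] unfolding dist_real_def by linarith
    then show "\<exists>N. \<forall>n\<ge>N. dist (E (v n)) (E g) < e" by blast
  qed
  moreover have "(\<lambda>n. norm2 M (\<lambda>x. v n x - b x)) \<longlonglongrightarrow> norm2 M (\<lambda>x. g x - b x)"
  proof (rule LIMSEQ_I)
    fix e :: real assume "0 < e"
    from LIMSEQ_D[OF g(2) this] obtain N where N: "\<And>n. N \<le> n \<Longrightarrow> norm2 M (\<lambda>x. g x - v n x) < e" by auto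
    have "\<bar>norm2 M (\<lambda>x. v n x - b x) - norm2 M (\<lambda>x. g x - b x)\<bar> \<le> norm2 M (\<lambda>x. g x - v n x)" for n
      using norm2_triangle_diff[OF g(1) v(1)[of n] b] norm2_triangle_diff[OF v(1)[of n] g(1) b]
        norm2_diff_commute[of M g "v n"] by simp
    then show "\<exists>N. \<forall>n\<ge>N. norm (norm2 M (\<lambda>x. v n x - b x) - norm2 M (\<lambda>x. g x - b x)) < e"
      using N by (intro exI[of _ N]) (fastforce intro: le_less_trans)
  qed
  ultimately have "(\<lambda>n. envelope (v n)) \<longlonglongrightarrow> envelope g"
    unfolding envelope_def by (intro tendsto_intros)
  moreover have "(\<lambda>n. m + \<eta> n) \<longlonglongrightarrow> m + a / 4 * 0\<^sup>2"
    unfolding \<eta>_def by (intro tendsto_intros LIMSEQ_power_zero) simp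
  ultimately have "envelope g \<le> m + a / 4 * 0\<^sup>2"
    by (rule LIMSEQ_le) (use v(2) in \<open>auto intro: less_imp_le\<close>)
  then have "envelope g \<le> envelope w" if "sq_integrable M w" for w
    using m[OF that] by simp
  then show ?thesis using g(1) that by blast
qed

text \<open>The optimality condition at the minimizer \<open>v\<close> gives a subgradient that
  attains \<open>E v\<close>. Passing from \<open>v\<close> to \<open>b\<close> cannot lower the
  pairing, and it raises \<open>E\<close> by at most \<open>L\<close> times the distance, which is
  at most \<open>L / (2 * a)\<close>.\<close>

lemma subgradient_almost_attaining:
  obtains \<Xi> where "subgradient \<Xi>" "E b - L\<^sup>2 / (2 * a) \<le> (\<integral>x. \<Xi> x \<bullet> b x \<partial>M)"
proof -
  obtain v where v: "sq_integrable M v" and min: "\<And>w. sq_integrable M w \<Longrightarrow> envelope v \<le> envelope w"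
    using envelope_minimizer by blast
  define p where "p x = v x - b x" for x
  \<comment> \<open>The negative gradient of the quadratic penalty at the minimizer; stationarity
    makes it a subgradient of \<open>E\<close> there.\<close>
  define \<Xi> where "\<Xi> x = (- 2 * a) *\<^sub>R p x" for x
  have p: "sq_integrable M p" unfolding p_def using v b by (rule sq_integrable_diff)
  have \<Xi>: "sq_integrable M \<Xi>" unfolding \<Xi>_def by (rule sq_integrable_scaleR[OF p])
  have ip: "(\<integral>x. \<Xi> x \<bullet> w x \<partial>M) = - 2 * a * (\<integral>x. p x \<bullet> w x \<partial>M)" for w
    by (simp add: \<Xi>_def)
  have opt: "s * (\<integral>x. \<Xi> x \<bullet> w x \<partial>M) \<le> (E (\<lambda>x. v x + s *\<^sub>R w x) - E v) + s\<^sup>2 * (a * (norm2 M w)\<^sup>2)"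
    if w: "sq_integrable M w" for s w
  proof -
    have "envelope v \<le> envelope (\<lambda>x. v x + s *\<^sub>R w x)"
      by (intro min sq_integrable_add v sq_integrable_scaleR w)
    moreover have "(norm2 M (\<lambda>x. v x + s *\<^sub>R w x - b x))\<^sup>2
        = (norm2 M p)\<^sup>2 + 2 * s * (\<integral>x. p x \<bullet> w x \<partial>M) + s\<^sup>2 * (norm2 M w)\<^sup>2"
      using norm2_add_scaleR_power2[OF p w, of s] by (simp add: p_def algebra_simps)
    ultimately show ?thesis
      unfolding envelope_def ip p_def[symmetric] by (simp add: algebra_simps)
  qed
  have "(\<integral>x. \<Xi> x \<bullet> w x \<partial>M) \<le> E w" if w: "sq_integrable M w" for w
  proof (rule le_of_le_add_small)
    fix s :: real assume "0 < s" "s < 1"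
    then have "E (\<lambda>x. v x + s *\<^sub>R w x) - E v \<le> s * E w"
      using subadditive[OF v sq_integrable_scaleR[OF w, of s]] homogeneous[OF w, of s] by simp
    then show "s * (\<integral>x. \<Xi> x \<bullet> w x \<partial>M) \<le> s * E w + s\<^sup>2 * (a * (norm2 M w)\<^sup>2)"
      using opt[OF w, of s] by linarith
  qed
  then have sub: "subgradient \<Xi>" using \<Xi> by (simp add: subgradient_def)
  \<comment> \<open>The direction \<open>- v\<close> keeps the perturbed point on the ray of
    \<open>v\<close> as long as \<open>s < 1\<close>, and on this ray homogeneity evaluates
    \<open>E\<close> exactly.\<close>
  have "E v \<le> (\<integral>x. \<Xi> x \<bullet> v x \<partial>M)"
  proof -
    have "- (\<integral>x. \<Xi> x \<bullet> v x \<partial>M) \<le> - E v"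
    proof (rule le_of_le_add_small)
      fix s :: real assume "0 < s" "s < 1"
      then have "E (\<lambda>x. v x + s *\<^sub>R (- 1) *\<^sub>R v x) = (1 - s) * E v"
        using homogeneous[OF v, of "1 - s"] by (simp add: algebra_simps)
      then show "s * (- (\<integral>x. \<Xi> x \<bullet> v x \<partial>M)) \<le> s * (- E v) + s\<^sup>2 * (a * (norm2 M v)\<^sup>2)"
        using opt[OF sq_integrable_scaleR[OF v, of "-1"], of s]
        by (simp add: norm2_minus algebra_simps)
    qed
    then show ?thesis by simp
  qed
  \<comment> \<open>By the definition of \<open>\<Xi>\<close>, \<open>b\<close> equals
    \<open>v\<close> plus \<open>\<Xi>\<close> divided by \<open>2 * a\<close>; pair this with
    \<open>\<Xi>\<close>.\<close>
  moreover have "(\<integral>x. \<Xi> x \<bullet> b x \<partial>M) = (\<integral>x. \<Xi> x \<bullet> v x \<partial>M) + (norm2 M \<Xi>)\<^sup>2 / (2 * a)"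
  proof -
    have "(\<integral>x. \<Xi> x \<bullet> \<Xi> x \<partial>M) = - 2 * a * ((\<integral>x. \<Xi> x \<bullet> v x \<partial>M) - (\<integral>x. \<Xi> x \<bullet> b x \<partial>M))"
      unfolding ip[of \<Xi>]
      by (subst inner_commute) (simp add: p_def inner_diff_right integrable_inner[OF \<Xi> v] integrable_inner[OF \<Xi> b])
    then show ?thesis using a by (simp add: norm2_power2 power2_norm_eq_inner field_simps)
  qed
  \<comment> \<open>\<open>\<Xi>\<close> is \<open>2 * a\<close> times as long as \<open>p\<close>,
    so the bound \<open>L\<close> on the norm of a subgradient bounds the distance from
    \<open>v\<close> to \<open>b\<close>.\<close>
  moreover have "E b \<le> E v + L\<^sup>2 / (2 * a)"
  proof -
    have n: "norm2 M \<Xi> = 2 * a * norm2 M p" unfolding \<Xi>_def norm2_scaleR using a by simp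
    then have "norm2 M p = norm2 M \<Xi> / (2 * a)" using a by simp
    also have "\<dots> \<le> L / (2 * a)" using subgradient_norm_le[OF sub] a by (intro divide_right_mono) auto
    finally have "L * norm2 M p \<le> L * (L / (2 * a))" using L_nonneg by (intro mult_left_mono)
    then show ?thesis
      using lipschitz[OF v b] unfolding p_def[symmetric] by (simp add: power2_eq_square)
  qed
  moreover have "0 \<le> (norm2 M \<Xi>)\<^sup>2 / (2 * a)" using a by simp
  ultimately have "E b - L\<^sup>2 / (2 * a) \<le> (\<integral>x. \<Xi> x \<bullet> b x \<partial>M)" by linarith
  then show ?thesis using sub that by blast
qed

end

lemma support_function:
  assumes b: "sq_integrable M b"
  shows "ereal (E b) = (SUP \<Xi>\<in>Collect subgradient. ereal (\<integral>x. \<Xi> x \<bullet> b x \<partial>M))"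
proof (rule antisym)
  show "(SUP \<Xi>\<in>Collect subgradient. ereal (\<integral>x. \<Xi> x \<bullet> b x \<partial>M)) \<le> ereal (E b)"
    using b by (intro SUP_least) (simp add: subgradient_def)
  show "ereal (E b) \<le> (SUP \<Xi>\<in>Collect subgradient. ereal (\<integral>x. \<Xi> x \<bullet> b x \<partial>M))"
  proof (rule ereal_le_epsilon2)
    fix e :: real assume e: "0 < e"
    \<comment> \<open>This value of the parameter \<open>a\<close> makes the defect at most
      \<open>e\<close>; the summand 1 keeps it positive when \<open>L = 0\<close>.\<close>
    have "0 < (L\<^sup>2 + 1) / e" using e by (intro divide_pos_pos) (auto intro: add_nonneg_pos)
    from subgradient_almost_attaining[OF b this] obtain \<Xi> where
      \<Xi>: "subgradient \<Xi>" "E b - L\<^sup>2 / (2 * ((L\<^sup>2 + 1) / e)) \<le> (\<integral>x. \<Xi> x \<bullet> b x \<partial>M)" by blast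
    have "L\<^sup>2 / (2 * ((L\<^sup>2 + 1) / e)) = e * (L\<^sup>2 / (2 * (L\<^sup>2 + 1)))" using e by simp
    also have "\<dots> \<le> e * 1"
    proof (rule mult_left_mono)
      have "L\<^sup>2 * 1 \<le> (2 * (L\<^sup>2 + 1)) * 1" by simp
      moreover have "0 < 2 * (L\<^sup>2 + 1)" by (simp add: add_nonneg_pos)
      ultimately show "L\<^sup>2 / (2 * (L\<^sup>2 + 1)) \<le> 1" by (simp only: pos_divide_le_eq mult_1_right mult_1_left)
    qed (use e in simp)
    finally have "ereal (E b) \<le> ereal (\<integral>x. \<Xi> x \<bullet> b x \<partial>M) + ereal e" using \<Xi>(2) by simp
    also have "\<dots> \<le> (SUP \<Xi>\<in>Collect subgradient. ereal (\<integral>x. \<Xi> x \<bullet> b x \<partial>M)) + ereal e"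
      using \<Xi>(1) by (intro add_right_mono SUP_upper) simp
    finally show "ereal (E b) \<le> (SUP \<Xi>\<in>Collect subgradient. ereal (\<integral>x. \<Xi> x \<bullet> b x \<partial>M)) + ereal e" .
  qed
qed

lemma subgradient_exists: "\<exists>\<Xi>. subgradient \<Xi>"
proof -
  have "sq_integrable M (\<lambda>x. 0)" by (simp add: sq_integrable_def)
  from subgradient_almost_attaining[OF this zero_less_one] show ?thesis by blast
qed

end

section \<open>Neighbourhoods and displacements in the Wasserstein space\<close>

lemma W2_ball_self: "\<mu> \<in> P2 \<Longrightarrow> 0 < r \<Longrightarrow> \<mu> \<in> W2_ball \<mu> r"
  using W2_self[of \<mu>] by (simp add: W2_ball_def)

lemma W2_ball_mono: "r \<le> s \<Longrightarrow> W2_ball \<mu> r \<subseteq> W2_ball \<mu> s"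
  by (auto simp: W2_ball_def)

lemma W2_ball_trans:
  assumes "\<mu> \<in> P2" "\<nu> \<in> W2_ball \<mu> r" "\<rho> \<in> W2_ball \<nu> s"
  shows "\<rho> \<in> W2_ball \<mu> (r + s)"
  using assms W2_triangle_less[of \<mu> \<nu> \<rho> r s] by (auto simp: W2_ball_def)

lemma eventually_W2_nhds:
  "eventually P (W2_nhds \<mu>) \<longleftrightarrow> (\<exists>r>0. \<forall>\<nu>\<in>W2_ball \<mu> r. P \<nu>)"
proof -
  have "eventually P (W2_nhds \<mu>) \<longleftrightarrow> (\<exists>r\<in>{0<..}. eventually P (principal (W2_ball \<mu> r)))"
    unfolding W2_nhds_def
  proof (rule eventually_INF_base)
    fix a b :: real assume "a \<in> {0<..}" "b \<in> {0<..}"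
    then show "\<exists>x\<in>{0<..}. principal (W2_ball \<mu> x) \<le> inf (principal (W2_ball \<mu> a)) (principal (W2_ball \<mu> b))"
      by (intro bexI[of _ "min a b"]) (auto simp: W2_ball_def)
  qed auto
  then show ?thesis by (simp add: eventually_principal Bex_def)
qed

text \<open>One \<open>d\<close> bounds both the radius and the time step. This form allows a
  property to be applied at a base point other than the current one, such as a displaced
  measure.\<close>

lemma eventually_W2_nhds_times_at_right:
  "eventually P (W2_nhds \<mu> \<times>\<^sub>F at_right (0::real)) \<longleftrightarrow>
    (\<exists>d>0. \<forall>\<nu>\<in>W2_ball \<mu> d. \<forall>t. 0 < t \<and> t < d \<longrightarrow> P (\<nu>, t))"
proof
  assume "eventually P (W2_nhds \<mu> \<times>\<^sub>F at_right (0::real))"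
  then obtain Q R where Q: "eventually Q (W2_nhds \<mu>)" and R: "eventually R (at_right (0::real))"
    and P: "\<And>\<nu> t. Q \<nu> \<Longrightarrow> R t \<Longrightarrow> P (\<nu>, t)"
    unfolding eventually_prod_filter by blast
  obtain r where r: "0 < r" "\<forall>\<nu>\<in>W2_ball \<mu> r. Q \<nu>" using Q unfolding eventually_W2_nhds by blast
  obtain s where s: "0 < s" "\<And>t. 0 < t \<Longrightarrow> t < s \<Longrightarrow> R t"
    using R unfolding eventually_at_right_field by auto
  show "\<exists>d>0. \<forall>\<nu>\<in>W2_ball \<mu> d. \<forall>t. 0 < t \<and> t < d \<longrightarrow> P (\<nu>, t)"
    using r s W2_ball_mono[of "min r s" r \<mu>] by (intro exI[of _ "min r s"]) (auto intro!: P)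
next
  assume "\<exists>d>0. \<forall>\<nu>\<in>W2_ball \<mu> d. \<forall>t. 0 < t \<and> t < d \<longrightarrow> P (\<nu>, t)"
  then obtain d where d: "0 < d" "\<And>\<nu> t. \<nu> \<in> W2_ball \<mu> d \<Longrightarrow> 0 < t \<Longrightarrow> t < d \<Longrightarrow> P (\<nu>, t)" by blast
  have "eventually (\<lambda>\<nu>. \<nu> \<in> W2_ball \<mu> d) (W2_nhds \<mu>)"
    unfolding eventually_W2_nhds using d(1) by blast
  moreover have "eventually (\<lambda>t. 0 < t \<and> t < d) (at_right (0::real))"
    unfolding eventually_at_right_field using d(1) by blast
  ultimately show "eventually P (W2_nhds \<mu> \<times>\<^sub>F at_right (0::real))"
    unfolding eventually_prod_filter using d(2) by blast
qed

lemma eventually_near: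
  assumes "0 < d"
  shows "\<forall>\<^sub>F p in W2_nhds \<mu> \<times>\<^sub>F at_right (0::real). fst p \<in> W2_ball \<mu> d \<and> 0 < snd p \<and> snd p < d"
  unfolding eventually_W2_nhds_times_at_right using assms by auto

text \<open>Lower bounds on the quotients pass to the upper limit only along a proper filter. The
  centre with a small time step is always available.\<close>

lemma W2_nhds_times_at_right_neq_bot:
  assumes "\<mu> \<in> P2"
  shows "W2_nhds \<mu> \<times>\<^sub>F at_right (0::real) \<noteq> bot"
  unfolding trivial_limit_def eventually_W2_nhds_times_at_right
proof clarify
  fix d :: real assume "0 < d" "\<forall>\<nu>\<in>W2_ball \<mu> d. \<forall>t. 0 < t \<and> t < d \<longrightarrow> False"
  then show False
    using W2_ball_self[OF assms \<open>0 < d\<close>] by (meson field_lbound_gt_zero)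
qed

section \<open>Displacements and their behaviour near the base measure\<close>

definition displace :: "'a::euclidean_space measure \<Rightarrow> real \<Rightarrow> ('a \<Rightarrow> 'a) \<Rightarrow> 'a measure" where
  "displace \<nu> t w = distr \<nu> borel (\<lambda>x. x + t *\<^sub>R w x)"

lemma sq_integrable_displacement:
  assumes "\<nu> \<in> P2" "w \<in> C1"
  shows "sq_integrable \<nu> (\<lambda>x. x + t *\<^sub>R w x)"
  using assms C1_sq_integrable_P2[OF assms(2,1)]
  by (intro sq_integrable_add sq_integrable_scaleR) (auto simp: P2_iff)

lemma displace_in_P2: "\<nu> \<in> P2 \<Longrightarrow> w \<in> C1 \<Longrightarrow> displace \<nu> t w \<in> P2"
  unfolding displace_def by (intro distr_in_P2 sq_integrable_displacement) (auto simp: P2_def)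

lemma distr_P2_ident: "\<nu> \<in> P2 \<Longrightarrow> distr \<nu> borel (\<lambda>x. x) = \<nu>"
  by (intro distr_id2) (simp add: P2_def)

lemma displace_zero: "\<nu> \<in> P2 \<Longrightarrow> displace \<nu> t (\<lambda>x. 0) = \<nu>"
  by (simp add: displace_def distr_P2_ident)

lemma displace_scaleR: "displace \<nu> t (\<lambda>x. c *\<^sub>R w x) = displace \<nu> (t * c) w"
  by (simp add: displace_def)

lemma displace_displace:
  assumes "\<nu> \<in> P2" "w1 \<in> C1" "w2 \<in> C1"
  shows "displace (displace \<nu> t w1) t w2
    = distr \<nu> borel (\<lambda>x. (x + t *\<^sub>R w1 x) + t *\<^sub>R w2 (x + t *\<^sub>R w1 x))"
proof -
  note [measurable] = C1_measurable[OF assms(2)] C1_measurable[OF assms(3)]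
  have [measurable_cong]: "sets \<nu> = sets borel" using assms(1) by (simp add: P2_def)
  show ?thesis unfolding displace_def by (subst distr_distr) (auto simp: comp_def)
qed

lemma W2_displace_le:
  assumes "\<nu> \<in> P2" "w1 \<in> C1" "w2 \<in> C1" "0 \<le> t"
  shows "W2 (displace \<nu> t w1) (displace \<nu> t w2) \<le> t * norm2 \<nu> (\<lambda>x. w1 x - w2 x)"
proof -
  have "W2 (displace \<nu> t w1) (displace \<nu> t w2)
      \<le> norm2 \<nu> (\<lambda>x. (x + t *\<^sub>R w1 x) - (x + t *\<^sub>R w2 x))"
    unfolding displace_def using assms
    by (intro W2_distr_le sq_integrable_measurable sq_integrable_displacement)
  also have "\<dots> = norm2 \<nu> (\<lambda>x. t *\<^sub>R (w1 x - w2 x))" by (simp add: algebra_simps)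
  finally show ?thesis using assms(4) by (simp add: norm2_scaleR del: scaleR_diff_right)
qed

text \<open>Along a nearly optimal coupling, \<open>w\<close> takes values at the two coordinates
  that are close in mean square, and the norms under the two marginals differ by at most that
  error.\<close>

lemma C1_norm_upper_semicontinuous:
  fixes w :: "'a::euclidean_space \<Rightarrow> 'a"
  assumes \<mu>: "\<mu> \<in> P2" and w: "w \<in> C1" and e: "0 < e"
  obtains d where "0 < d" "\<And>\<nu>. \<nu> \<in> W2_ball \<mu> d \<Longrightarrow> norm2 \<nu> w < norm2 \<mu> w + e"
proof -
  obtain d where d: "0 < d" "\<And>(M :: ('a \<times> 'a) measure) X Y. prob_space M \<Longrightarrow> sq_integrable M X \<Longrightarrow>
    sq_integrable M Y \<Longrightarrow> distr M borel X = \<mu> \<Longrightarrow> norm2 M (\<lambda>\<omega>. X \<omega> - Y \<omega>) < d \<Longrightarrow>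
    norm2 M (\<lambda>\<omega>. w (Y \<omega>) - w (X \<omega>)) < e"
    using C1_composition_continuous[OF w \<mu> e] by blast
  have "norm2 \<nu> w < norm2 \<mu> w + e" if \<nu>: "\<nu> \<in> W2_ball \<mu> d" for \<nu>
  proof -
    have P: "\<nu> \<in> P2" "W2 \<mu> \<nu> < d" using \<nu> by (auto simp: W2_ball_def)
    obtain \<pi> where \<pi>: "\<pi> \<in> couplings \<mu> \<nu>" "norm2 \<pi> (\<lambda>p. fst p - snd p) < d"
      using W2_less_coupling[OF \<mu> P] .
    have pr: "prob_space \<pi>" using prob_space_coupling[OF \<pi>(1)] \<mu> by (simp add: P2_def)
    note sq = sq_integrable_coupling[OF \<pi>(1) \<mu> P(1)]
    note m = measurable_fst_snd_couplings[OF \<pi>(1)]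
    have D: "distr \<pi> borel fst = \<mu>" "distr \<pi> borel snd = \<nu>" using \<pi>(1) by (auto simp: couplings_def)
    have "norm2 \<pi> (\<lambda>p. w (snd p) - w (fst p)) < e" by (rule d(2)[OF pr sq D(1) \<pi>(2)])
    moreover have "norm2 \<pi> (\<lambda>p. w (snd p)) \<le> norm2 \<pi> (\<lambda>p. w (fst p)) + norm2 \<pi> (\<lambda>p. w (snd p) - w (fst p))"
      by (intro norm2_le_norm2_add_diff C1_sq_integrable[OF w pr] sq)
    moreover have "norm2 \<pi> (\<lambda>p. w (snd p)) = norm2 \<nu> w" "norm2 \<pi> (\<lambda>p. w (fst p)) = norm2 \<mu> w"
      using norm2_distr[OF m(1) C1_measurable[OF w]] norm2_distr[OF m(2) C1_measurable[OF w]] D by simp_all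
    ultimately show ?thesis by simp
  qed
  then show ?thesis using that d(1) by blast
qed

lemma eventually_norm2_less:
  assumes "\<mu> \<in> P2" "w \<in> C1" "0 < e"
  shows "\<forall>\<^sub>F p in W2_nhds \<mu> \<times>\<^sub>F at_right (0::real). norm2 (fst p) w < norm2 \<mu> w + e"
proof -
  obtain d where d: "0 < d" "\<And>\<nu>. \<nu> \<in> W2_ball \<mu> d \<Longrightarrow> norm2 \<nu> w < norm2 \<mu> w + e"
    using C1_norm_upper_semicontinuous[OF assms] by blast
  show ?thesis using eventually_near[OF d(1)] by eventually_elim (auto intro: d(2))
qed

lemma eventually_displacement_small:
  assumes "\<mu> \<in> P2" "w \<in> C1" "0 < e"
  shows "\<forall>\<^sub>F p in W2_nhds \<mu> \<times>\<^sub>F at_right (0::real). snd p * norm2 (fst p) w < e"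
proof -
  have n: "0 < norm2 \<mu> w + 1" by (simp add: add_nonneg_pos)
  have "0 < e / (norm2 \<mu> w + 1)" using n assms(3) by simp
  from eventually_near[OF this] eventually_norm2_less[OF assms(1,2) zero_less_one]
  show ?thesis
  proof eventually_elim
    case (elim p)
    then have "snd p * norm2 (fst p) w \<le> snd p * (norm2 \<mu> w + 1)" by (intro mult_left_mono) auto
    also have "\<dots> < e" using elim n by (simp add: pos_less_divide_eq)
    finally show ?case .
  qed
qed

lemma eventually_displace_in_ball:
  assumes \<mu>: "\<mu> \<in> P2" and w: "w \<in> C1" and r: "0 < r"
  shows "\<forall>\<^sub>F p in W2_nhds \<mu> \<times>\<^sub>F at_right (0::real). displace (fst p) (snd p) w \<in> W2_ball \<mu> r"
proof -
  have "0 < r / 2" using r by simp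
  from eventually_near[OF this, of \<mu>] eventually_displacement_small[OF \<mu> w this]
  show ?thesis
  proof eventually_elim
    case (elim p)
    then have P: "fst p \<in> P2" by (auto simp: W2_ball_def)
    have "W2 (fst p) (displace (fst p) (snd p) w) \<le> snd p * norm2 (fst p) w"
      using W2_displace_le[OF P C1_zero w, of "snd p"] elim
      by (simp add: displace_zero[OF P] norm2_minus)
    then have "displace (fst p) (snd p) w \<in> W2_ball (fst p) (r / 2)"
      using elim displace_in_P2[OF P w] by (simp add: W2_ball_def)
    from W2_ball_trans[OF \<mu> _ this] elim show ?case by fastforce
  qed
qed

text \<open>The base measure moves, whereas \<open>C1_composition_continuous\<close> compares only
  with a variable of law \<open>\<mu>\<close>. Hence the point and its displacement are both
  compared with the \<open>\<mu>\<close>-distributed coordinate of a coupling, at a cost of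
  \<open>e / 2\<close> each.\<close>

lemma eventually_C1_shift_small:
  fixes w1 w2 :: "'a::euclidean_space \<Rightarrow> 'a"
  assumes \<mu>: "\<mu> \<in> P2" and w1: "w1 \<in> C1" and w2: "w2 \<in> C1" and e: "0 < e"
  shows "\<forall>\<^sub>F p in W2_nhds \<mu> \<times>\<^sub>F at_right (0::real).
    norm2 (fst p) (\<lambda>x. w2 (x + snd p *\<^sub>R w1 x) - w2 x) < e"
proof -
  have "0 < e / 2" using e by simp
  then obtain d where d: "0 < d" "\<And>(M :: ('a \<times> 'a) measure) X Y. prob_space M \<Longrightarrow> sq_integrable M X \<Longrightarrow>
    sq_integrable M Y \<Longrightarrow> distr M borel X = \<mu> \<Longrightarrow> norm2 M (\<lambda>\<omega>. X \<omega> - Y \<omega>) < d \<Longrightarrow>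
    norm2 M (\<lambda>\<omega>. w2 (Y \<omega>) - w2 (X \<omega>)) < e / 2"
    using C1_composition_continuous[OF w2 \<mu>] by blast
  have d2: "0 < d / 2" using d(1) by simp
  from eventually_near[OF d2, of \<mu>] eventually_displacement_small[OF \<mu> w1 d2]
  show ?thesis
  proof eventually_elim
    case (elim p)
    define \<nu> t where "\<nu> = fst p" and "t = snd p"
    have P: "\<nu> \<in> P2" "W2 \<mu> \<nu> < d / 2" and t: "0 < t" and tn: "t * norm2 \<nu> w1 < d / 2"
      using elim by (auto simp: W2_ball_def \<nu>_def t_def)
    obtain \<pi> where \<pi>: "\<pi> \<in> couplings \<mu> \<nu>" "norm2 \<pi> (\<lambda>p. fst p - snd p) < d / 2"
      using W2_less_coupling[OF \<mu> P] .
    have pr: "prob_space \<pi>" using prob_space_coupling[OF \<pi>(1)] \<mu> by (simp add: P2_def)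
    note sq = sq_integrable_coupling[OF \<pi>(1) \<mu> P(1)]
    note m = measurable_fst_snd_couplings[OF \<pi>(1)]
    have D: "distr \<pi> borel fst = \<mu>" "distr \<pi> borel snd = \<nu>" using \<pi>(1) by (auto simp: couplings_def)
    define Z where "Z q = snd q + t *\<^sub>R w1 (snd q)" for q :: "'a \<times> 'a"
    have sw1: "sq_integrable \<pi> (\<lambda>q. w1 (snd q))" by (rule C1_sq_integrable[OF w1 pr sq(2)])
    have Z: "sq_integrable \<pi> Z"
      unfolding Z_def by (intro sq_integrable_add sq_integrable_scaleR sq(2) sw1)
    have "norm2 \<pi> (\<lambda>q. snd q - Z q) = t * norm2 \<nu> w1"
      using t norm2_distr[OF m(2) C1_measurable[OF w1]] by (simp add: Z_def norm2_minus norm2_scaleR D)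
    then have "norm2 \<pi> (\<lambda>q. fst q - Z q) < d"
      using norm2_triangle_diff[OF sq Z] \<pi>(2) tn by simp
    from d(2)[OF pr sq(1) Z D(1) this]
    have 1: "norm2 \<pi> (\<lambda>q. w2 (Z q) - w2 (fst q)) < e / 2" .
    have "norm2 \<pi> (\<lambda>q. fst q - snd q) < d" using \<pi>(2) d(1) by simp
    from d(2)[OF pr sq D(1) this]
    have 2: "norm2 \<pi> (\<lambda>q. w2 (snd q) - w2 (fst q)) < e / 2" .
    note s = C1_sq_integrable[OF w2 pr]
    have "norm2 \<pi> (\<lambda>q. w2 (Z q) - w2 (snd q)) < e"
      using norm2_triangle_diff[OF s[OF Z] s[OF sq(1)] s[OF sq(2)]] 1 2
        norm2_diff_commute[of \<pi> "\<lambda>q. w2 (fst q)" "\<lambda>q. w2 (snd q)"] by simp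
    moreover have "(\<lambda>x. w2 (x + t *\<^sub>R w1 x) - w2 x) \<in> borel_measurable borel"
      using C1_measurable[OF w1] C1_measurable[OF w2] by measurable
    from norm2_distr[OF m(2) this]
    have "norm2 \<nu> (\<lambda>x. w2 (x + t *\<^sub>R w1 x) - w2 x) = norm2 \<pi> (\<lambda>q. w2 (Z q) - w2 (snd q))"
      by (simp add: D Z_def)
    ultimately show ?case by (simp add: \<nu>_def t_def)
  qed
qed

section \<open>The generalized derivative\<close>

lemma gen_deriv_displace:
  "gen_deriv \<G> \<mu> w = Limsup (W2_nhds \<mu> \<times>\<^sub>F at_right 0)
     (\<lambda>p. ereal ((\<G> (displace (fst p) (snd p) w) - \<G> (fst p)) / snd p))"
  by (simp add: gen_deriv_def displace_def case_prod_beta')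

text \<open>A bound on the quotients over a whole ball controls the derivative at every centre in
  the ball of half the radius, because small balls around that centre stay inside.\<close>

lemma gen_deriv_upper_semicontinuous:
  assumes U: "W2_open U"
  shows "W2_usc_on U (\<lambda>\<nu>. gen_deriv \<G> \<nu> w)"
  unfolding W2_usc_on_def Limsup_le_iff
proof (intro ballI allI impI)
  fix \<nu> c assume \<nu>: "\<nu> \<in> U" and c: "gen_deriv \<G> \<nu> w < c"
  have \<nu>2: "\<nu> \<in> P2" using \<nu> U by (auto simp: W2_open_def)
  \<comment> \<open>A value strictly in between, since a pointwise bound on the quotients gives only
    a weak inequality for their upper limit.\<close>
  obtain b where b: "gen_deriv \<G> \<nu> w < b" "b < c" using dense[OF c] by blast
  let ?q = "\<lambda>p. ereal ((\<G> (displace (fst p) (snd p) w) - \<G> (fst p)) / snd p)"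
  have "\<forall>\<^sub>F p in W2_nhds \<nu> \<times>\<^sub>F at_right 0. ?q p < b"
    using b(1) unfolding gen_deriv_displace by (rule Limsup_lessD)
  then obtain d where d: "0 < d" "\<And>\<nu>' t. \<nu>' \<in> W2_ball \<nu> d \<Longrightarrow> 0 < t \<Longrightarrow> t < d \<Longrightarrow> ?q (\<nu>', t) < b"
    unfolding eventually_W2_nhds_times_at_right by blast
  have "gen_deriv \<G> \<nu>' w < c" if \<nu>': "\<nu>' \<in> W2_ball \<nu> (d / 2)" for \<nu>'
  proof -
    have "\<forall>\<^sub>F p in W2_nhds \<nu>' \<times>\<^sub>F at_right 0. ?q p \<le> b"
      using eventually_near[OF half_gt_zero[OF d(1)], of \<nu>']
    proof eventually_elim
      case (elim p)
      then have "fst p \<in> W2_ball \<nu> (d / 2 + d / 2)" using W2_ball_trans[OF \<nu>2 \<nu>'] by blast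
      then show ?case using d(2)[of "fst p" "snd p"] elim d(1) by (simp add: less_imp_le)
    qed
    then have "gen_deriv \<G> \<nu>' w \<le> b" unfolding gen_deriv_displace by (rule Limsup_bounded)
    then show ?thesis using b(2) by simp
  qed
  then have "\<forall>\<^sub>F \<nu>' in W2_nhds \<nu>. gen_deriv \<G> \<nu>' w < c"
    unfolding eventually_W2_nhds using d(1) by (intro exI[of _ "d / 2"]) auto
  then show "\<forall>\<^sub>F \<nu>' in inf (W2_nhds \<nu>) (principal U). gen_deriv \<G> \<nu>' w < c"
    by (rule filter_leD[OF inf_le1])
qed

lemma le_of_le_add_mult:
  fixes a b c :: real
  assumes "\<And>s. 0 < s \<Longrightarrow> a \<le> b + c * s"
  shows "a \<le> b"
proof (rule le_of_le_add_small)
  fix s :: real assume "0 < s" "s < 1"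
  then show "s * a \<le> s * b + s\<^sup>2 * c"
    using mult_left_mono[OF assms[of s], of s] by (simp add: power2_eq_square algebra_simps)
qed

section \<open>Calculus of the generalized derivative under a Lipschitz bound\<close>

locale W2_lipschitz_near =
  fixes \<G> :: "'a::euclidean_space measure \<Rightarrow> real" and \<mu> :: "'a measure" and L r :: real
  assumes \<mu>: "\<mu> \<in> P2" and r: "0 < r" and lip: "W2_lipschitz_on L (W2_ball \<mu> r) \<G>"
begin

lemma L_nonneg: "0 \<le> L"
  using lip by (simp add: W2_lipschitz_on_def)

lemma lipschitz_ball:
  "\<nu> \<in> W2_ball \<mu> r \<Longrightarrow> \<nu>' \<in> W2_ball \<mu> r \<Longrightarrow> \<bar>\<G> \<nu> - \<G> \<nu>'\<bar> \<le> L * W2 \<nu> \<nu>'"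
  using lip by (simp add: W2_lipschitz_on_def)

abbreviation near :: "('a measure \<times> real) filter" where
  "near \<equiv> W2_nhds \<mu> \<times>\<^sub>F at_right 0"

definition quotient :: "('a \<Rightarrow> 'a) \<Rightarrow> 'a measure \<times> real \<Rightarrow> real" where
  "quotient w p = (\<G> (displace (fst p) (snd p) w) - \<G> (fst p)) / snd p"

lemma gen_deriv_quotient: "gen_deriv \<G> \<mu> w = Limsup near (\<lambda>p. ereal (quotient w p))"
  by (simp add: gen_deriv_displace quotient_def)

text \<open>Both displacements start from the same measure. Its norm is replaced by the norm at
  \<open>\<mu>\<close> at the price of \<open>e\<close>, by upper semicontinuity. With
  \<open>w2\<close> equal to zero this bounds a single quotient.\<close>

lemma eventually_displace_close:
  assumes w1: "w1 \<in> C1" and w2: "w2 \<in> C1" and e: "0 < e"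
  shows "\<forall>\<^sub>F p in near. \<bar>\<G> (displace (fst p) (snd p) w1) - \<G> (displace (fst p) (snd p) w2)\<bar>
    \<le> snd p * (L * (norm2 \<mu> (\<lambda>x. w1 x - w2 x) + e))"
  using eventually_near[OF r] eventually_displace_in_ball[OF \<mu> w1 r]
    eventually_displace_in_ball[OF \<mu> w2 r] eventually_norm2_less[OF \<mu> C1_diff[OF w1 w2] e]
proof eventually_elim
  case (elim p)
  then have P: "fst p \<in> P2" by (auto simp: W2_ball_def)
  have "W2 (displace (fst p) (snd p) w1) (displace (fst p) (snd p) w2)
      \<le> snd p * norm2 (fst p) (\<lambda>x. w1 x - w2 x)"
    using elim by (intro W2_displace_le P w1 w2) auto
  also have "\<dots> \<le> snd p * (norm2 \<mu> (\<lambda>x. w1 x - w2 x) + e)"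
    using elim by (intro mult_left_mono) auto
  finally have "L * W2 (displace (fst p) (snd p) w1) (displace (fst p) (snd p) w2)
      \<le> L * (snd p * (norm2 \<mu> (\<lambda>x. w1 x - w2 x) + e))"
    using L_nonneg by (rule mult_left_mono)
  then show ?case using lipschitz_ball[OF elim(2,3)] by (simp add: mult.left_commute)
qed

lemma eventually_abs_quotient_le:
  assumes w: "w \<in> C1" and e: "0 < e"
  shows "\<forall>\<^sub>F p in near. \<bar>quotient w p\<bar> \<le> L * (norm2 \<mu> w + e)"
  using eventually_near[OF r] eventually_displace_close[OF w C1_zero e]
proof eventually_elim
  case (elim p)
  then have P: "fst p \<in> P2" by (auto simp: W2_ball_def)
  show ?case
    using elim by (simp add: quotient_def displace_zero[OF P] abs_div pos_divide_le_eq mult.commute)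
qed

text \<open>\<open>real_of_ereal\<close> sends infinite values to 0. On \<open>C1\<close> this
  default never occurs, by \<open>gen_deriv_eq_D\<close>.\<close>

definition D :: "('a \<Rightarrow> 'a) \<Rightarrow> real" where
  "D w = real_of_ereal (gen_deriv \<G> \<mu> w)"

text \<open>The two-sided bound for a single \<open>e\<close> already gives finiteness; letting
  \<open>e\<close> tend to 0 gives the sharp constant.\<close>

lemma gen_deriv_eq_D:
  assumes w: "w \<in> C1"
  shows "gen_deriv \<G> \<mu> w = ereal (D w)" "\<bar>D w\<bar> \<le> L * norm2 \<mu> w"
proof -
  have up: "gen_deriv \<G> \<mu> w \<le> ereal (L * (norm2 \<mu> w + e))" if "0 < e" for e
    unfolding gen_deriv_quotient using eventually_abs_quotient_le[OF w that]
    by (intro Limsup_bounded) (auto elim: eventually_mono)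
  have lo: "ereal (- (L * (norm2 \<mu> w + e))) \<le> gen_deriv \<G> \<mu> w" if "0 < e" for e
    unfolding gen_deriv_quotient using eventually_abs_quotient_le[OF w that]
    by (intro le_Limsup W2_nhds_times_at_right_neq_bot \<mu>) (auto elim!: eventually_mono)
  have "\<bar>gen_deriv \<G> \<mu> w\<bar> \<noteq> \<infinity>" using up[of 1] lo[of 1] by auto
  then show eq: "gen_deriv \<G> \<mu> w = ereal (D w)" by (simp add: D_def ereal_real)
  have "D w \<le> L * norm2 \<mu> w"
    by (rule le_of_le_add_mult[of _ _ L]) (use up eq in \<open>simp add: algebra_simps\<close>)
  moreover have "- D w \<le> L * norm2 \<mu> w"
    by (rule le_of_le_add_mult[of _ _ L]) (use lo eq in \<open>force simp: algebra_simps\<close>)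
  ultimately show "\<bar>D w\<bar> \<le> L * norm2 \<mu> w" by simp
qed

text \<open>With \<open>eventually_quotient_less\<close>, this is the real-valued interface to the
  upper limit: one rule to bound it from above, one to exploit such a bound.\<close>

lemma D_leI:
  assumes "w \<in> C1" "\<forall>\<^sub>F p in near. quotient w p \<le> c"
  shows "D w \<le> c"
proof -
  have "gen_deriv \<G> \<mu> w \<le> ereal c"
    unfolding gen_deriv_quotient using assms(2) by (intro Limsup_bounded) simp
  then show ?thesis using gen_deriv_eq_D(1)[OF assms(1)] by simp
qed

lemma eventually_quotient_less:
  assumes "w \<in> C1" "D w < c"
  shows "\<forall>\<^sub>F p in near. quotient w p < c"
proof -
  have "gen_deriv \<G> \<mu> w < ereal c" using assms gen_deriv_eq_D(1) by simp
  from Limsup_lessD[OF this[unfolded gen_deriv_quotient]] show ?thesis by simp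
qed

text \<open>The value at the base point cancels in the difference of the two quotients, which leaves
  the displacement estimate.\<close>

lemma D_le_add:
  assumes w1: "w1 \<in> C1" and w2: "w2 \<in> C1"
  shows "D w2 \<le> D w1 + L * norm2 \<mu> (\<lambda>x. w2 x - w1 x)"
proof (rule le_of_le_add_mult[of _ _ "1 + L"])
  fix e :: real assume e: "0 < e"
  then have "D w1 < D w1 + e" by simp
  from eventually_quotient_less[OF w1 this] eventually_displace_close[OF w2 w1 e] eventually_near[OF r]
  have "\<forall>\<^sub>F p in near. quotient w2 p \<le> D w1 + e + L * (norm2 \<mu> (\<lambda>x. w2 x - w1 x) + e)"
  proof eventually_elim
    case (elim p)
    have "quotient w2 p - quotient w1 p
        = (\<G> (displace (fst p) (snd p) w2) - \<G> (displace (fst p) (snd p) w1)) / snd p"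
      by (simp add: quotient_def diff_divide_distrib)
    also have "\<dots> \<le> L * (norm2 \<mu> (\<lambda>x. w2 x - w1 x) + e)"
      using elim by (simp add: pos_divide_le_eq mult.commute)
    finally show ?case using elim by linarith
  qed
  from D_leI[OF w2 this]
  show "D w2 \<le> D w1 + L * norm2 \<mu> (\<lambda>x. w2 x - w1 x) + (1 + L) * e" by (simp add: algebra_simps)
qed

lemma D_lipschitz:
  assumes "w1 \<in> C1" "w2 \<in> C1"
  shows "\<bar>D w2 - D w1\<bar> \<le> L * norm2 \<mu> (\<lambda>x. w2 x - w1 x)"
  using D_le_add[OF assms] D_le_add[OF assms(2,1)] norm2_diff_commute[of \<mu> w1 w2] by simp

text \<open>Scaling the map by \<open>c\<close> is the same as scaling the time step by
  \<open>c\<close>, so the quotient at \<open>t\<close> is \<open>c\<close> times the quotient of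
  \<open>w\<close> at \<open>t * c\<close>. The second radius \<open>d / c\<close> keeps this new
  step below \<open>d\<close>.\<close>

lemma D_scaleR_le:
  assumes w: "w \<in> C1" and c: "0 < c"
  shows "D (\<lambda>x. c *\<^sub>R w x) \<le> c * D w"
proof (rule le_of_le_add_mult[of _ _ c])
  fix e :: real assume e: "0 < e"
  then have "D w < D w + e" by simp
  from eventually_quotient_less[OF w this] obtain d where d: "0 < d"
    "\<And>\<nu> t. \<nu> \<in> W2_ball \<mu> d \<Longrightarrow> 0 < t \<Longrightarrow> t < d \<Longrightarrow> quotient w (\<nu>, t) < D w + e"
    unfolding eventually_W2_nhds_times_at_right by blast
  have "0 < d / c" using d(1) c by simp
  from eventually_near[OF d(1), of \<mu>] eventually_near[OF this, of \<mu>]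
  have "\<forall>\<^sub>F p in near. quotient (\<lambda>x. c *\<^sub>R w x) p \<le> c * (D w + e)"
  proof eventually_elim
    case (elim p)
    then have "quotient w (fst p, snd p * c) < D w + e"
      using c by (intro d(2)) (auto simp: pos_less_divide_eq)
    moreover have "quotient (\<lambda>x. c *\<^sub>R w x) p = c * quotient w (fst p, snd p * c)"
      using c by (simp add: quotient_def displace_scaleR)
    ultimately show ?case using c by simp
  qed
  from D_leI[OF C1_scaleR[OF w] this]
  show "D (\<lambda>x. c *\<^sub>R w x) \<le> c * D w + c * e" by (simp add: algebra_simps)
qed

lemma D_scaleR:
  assumes w: "w \<in> C1" and c: "0 \<le> c"
  shows "D (\<lambda>x. c *\<^sub>R w x) = c * D w"
proof (cases "c = 0")
  case True
  then show ?thesis using gen_deriv_eq_D(2)[OF C1_zero] by simp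
next
  case False
  then have "0 < c" using c by simp
  \<comment> \<open>The reverse inequality is the same estimate for the factor \<open>1 / c\<close>,
    applied to the scaled map.\<close>
  have "D w \<le> (1 / c) * D (\<lambda>x. c *\<^sub>R w x)"
    using D_scaleR_le[OF C1_scaleR[OF w], of "1 / c" c] \<open>0 < c\<close> by simp
  then show ?thesis using D_scaleR_le[OF w \<open>0 < c\<close>] \<open>0 < c\<close> by (simp add: field_simps)
qed

text \<open>
  Displacing along \<open>w1\<close> and then along \<open>w2\<close> differs from displacing along the sum by the shift
  of the argument of \<open>w2\<close>, which is negligible relative to the time step. The base point of the
  second displacement varies, which is why the upper limit over base points is subadditive.
\<close>

lemma D_add_le:
  assumes w1: "w1 \<in> C1" and w2: "w2 \<in> C1"
  shows "D (\<lambda>x. w1 x + w2 x) \<le> D w1 + D w2"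
proof (rule le_of_le_add_mult[of _ _ "2 + L"])
  fix e :: real assume e: "0 < e"
  then have "D w1 < D w1 + e" "D w2 < D w2 + e" by simp_all
  \<comment> \<open>Radii are extracted here because the bound, like the ball membership that
    follows, will be applied at the displaced base point \<open>\<nu>1\<close> and not at the point
    of the filter.\<close>
  from eventually_quotient_less[OF w2 this(2)] obtain d where d: "0 < d"
    "\<And>\<nu> t. \<nu> \<in> W2_ball \<mu> d \<Longrightarrow> 0 < t \<Longrightarrow> t < d \<Longrightarrow> quotient w2 (\<nu>, t) < D w2 + e"
    unfolding eventually_W2_nhds_times_at_right by blast
  from eventually_displace_in_ball[OF \<mu> w2 r] obtain d' where d': "0 < d'"
    "\<And>\<nu> t. \<nu> \<in> W2_ball \<mu> d' \<Longrightarrow> 0 < t \<Longrightarrow> t < d' \<Longrightarrow> displace \<nu> t w2 \<in> W2_ball \<mu> r"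
    unfolding eventually_W2_nhds_times_at_right by auto
  \<comment> \<open>One \<open>e\<close> comes from each quotient and \<open>L * e\<close> from the
    shift, which explains the factor \<open>2 + L\<close>.\<close>
  have "\<forall>\<^sub>F p in near. quotient (\<lambda>x. w1 x + w2 x) p \<le> D w1 + e + (D w2 + e) + L * e"
    using eventually_quotient_less[OF w1 \<open>D w1 < D w1 + e\<close>] eventually_near[OF d(1), of \<mu>]
      eventually_near[OF d'(1), of \<mu>] eventually_displace_in_ball[OF \<mu> w1 d(1)]
      eventually_displace_in_ball[OF \<mu> w1 d'(1)] eventually_displace_in_ball[OF \<mu> C1_add[OF w1 w2] r]
      eventually_C1_shift_small[OF \<mu> w1 w2 e]
  proof eventually_elim
    case (elim p)
    define \<nu> t where "\<nu> = fst p" and "t = snd p"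
    define \<nu>1 where "\<nu>1 = displace \<nu> t w1"
    have P: "\<nu> \<in> P2" and t: "0 < t" "t < d" "t < d'" using elim by (auto simp: W2_ball_def \<nu>_def t_def)
    have q2: "quotient w2 (\<nu>1, t) < D w2 + e"
      using elim t by (intro d(2)) (auto simp: \<nu>1_def \<nu>_def t_def)
    have in_ball: "displace \<nu>1 t w2 \<in> W2_ball \<mu> r"
      using elim t by (intro d'(2)) (auto simp: \<nu>1_def \<nu>_def t_def)
    note [measurable] = C1_measurable[OF w1] C1_measurable[OF w2]
    have [measurable_cong]: "sets \<nu> = sets borel" using P by (simp add: P2_def)
    have "W2 (displace \<nu> t (\<lambda>x. w1 x + w2 x)) (displace \<nu>1 t w2)
        \<le> norm2 \<nu> (\<lambda>x. (x + t *\<^sub>R (w1 x + w2 x)) - ((x + t *\<^sub>R w1 x) + t *\<^sub>R w2 (x + t *\<^sub>R w1 x)))"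
      unfolding \<nu>1_def displace_displace[OF P w1 w2]
      unfolding displace_def by (intro W2_distr_le) measurable
    also have "\<dots> = norm2 \<nu> (\<lambda>x. t *\<^sub>R (w2 x - w2 (x + t *\<^sub>R w1 x)))"
      by (simp add: algebra_simps)
    also have "\<dots> = t * norm2 \<nu> (\<lambda>x. w2 (x + t *\<^sub>R w1 x) - w2 x)"
      using t by (simp add: norm2_scaleR norm2_diff_commute[of \<nu> w2] del: scaleR_diff_right)
    also have "\<dots> \<le> t * e" using elim(7) t by (simp add: \<nu>_def t_def)
    finally have "L * W2 (displace \<nu> t (\<lambda>x. w1 x + w2 x)) (displace \<nu>1 t w2) \<le> L * (t * e)"
      using L_nonneg by (rule mult_left_mono)
    then have "\<G> (displace \<nu> t (\<lambda>x. w1 x + w2 x)) - \<G> (displace \<nu>1 t w2) \<le> L * e * t"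
      using lipschitz_ball[OF _ in_ball, of "displace \<nu> t (\<lambda>x. w1 x + w2 x)"] elim(6)
      by (simp add: \<nu>_def t_def mult.assoc mult.commute[of e])
    then have "(\<G> (displace \<nu> t (\<lambda>x. w1 x + w2 x)) - \<G> (displace \<nu>1 t w2)) / t \<le> L * e"
      using t by (simp add: pos_divide_le_eq)
    \<comment> \<open>Telescoping through the two-step displacement: shift error, second step from
      \<open>\<nu>1\<close>, first step from \<open>\<nu>\<close>.\<close>
    moreover have "quotient (\<lambda>x. w1 x + w2 x) p
        = (\<G> (displace \<nu> t (\<lambda>x. w1 x + w2 x)) - \<G> (displace \<nu>1 t w2)) / t + quotient w2 (\<nu>1, t) + quotient w1 p"
      by (simp add: quotient_def \<nu>1_def \<nu>_def t_def diff_divide_distrib)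
    ultimately show ?case using elim(1) q2 by linarith
  qed
  from D_leI[OF C1_add[OF w1 w2] this]
  show "D (\<lambda>x. w1 x + w2 x) \<le> D w1 + D w2 + (2 + L) * e" by (simp add: algebra_simps)
qed

end

section \<open>The continuous extension and the Clarke subdifferential\<close>

lemma L2_iff: "f \<in> L2 \<mu> \<longleftrightarrow> sq_integrable \<mu> f"
  by (simp add: L2_def sq_integrable_def)

lemma L2_norm_eq: "L2_norm \<mu> f = norm2 \<mu> f"
  by (simp add: L2_norm_def norm2_def)

context W2_lipschitz_near
begin

lemma C1_sq: "w \<in> C1 \<Longrightarrow> sq_integrable \<mu> w"
  using C1_sq_integrable_P2 \<mu> by blast

text \<open>McShane's formula extends a Lipschitz function without any limit process.\<close>

definition E :: "('a \<Rightarrow> 'a) \<Rightarrow> real" where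
  "E f = (INF w\<in>C1. D w + L * norm2 \<mu> (\<lambda>x. f x - w x))"

text \<open>The real infimum is a genuine lower bound only for families bounded below. Here
  \<open>D v\<close> is at least \<open>- L\<close> times the norm of \<open>v\<close>, so the
  triangle inequality bounds the family from below by \<open>- L\<close> times the norm of
  \<open>f\<close>.\<close>

lemma E_le:
  assumes f: "sq_integrable \<mu> f" and w: "w \<in> C1"
  shows "E f \<le> D w + L * norm2 \<mu> (\<lambda>x. f x - w x)"
  unfolding E_def
proof (rule cINF_lower[OF bdd_belowI2 w])
  fix v :: "'a \<Rightarrow> 'a" assume v: "v \<in> C1"
  have "L * norm2 \<mu> v \<le> L * (norm2 \<mu> f + norm2 \<mu> (\<lambda>x. f x - v x))"
    using norm2_le_norm2_add_diff[OF C1_sq[OF v] f] norm2_diff_commute[of \<mu> f v] L_nonneg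
    by (intro mult_left_mono) auto
  then show "- (L * norm2 \<mu> f) \<le> D v + L * norm2 \<mu> (\<lambda>x. f x - v x)"
    using gen_deriv_eq_D(2)[OF v] by (simp add: algebra_simps)
qed

text \<open>The Lipschitz bound on \<open>D\<close> says precisely that no competitor in the infimum
  falls below the value at \<open>w\<close> itself.\<close>

lemma E_eq_D:
  assumes w: "w \<in> C1"
  shows "E w = D w"
proof (rule antisym)
  show "E w \<le> D w" using E_le[OF C1_sq[OF w] w] by simp
  show "D w \<le> E w"
    unfolding E_def using C1_zero D_le_add[OF _ w] by (intro cINF_greatest) auto
qed

lemma E_le_add:
  assumes f: "sq_integrable \<mu> f" and g: "sq_integrable \<mu> g"
  shows "E f \<le> E g + L * norm2 \<mu> (\<lambda>x. f x - g x)"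
proof -
  have "E f - L * norm2 \<mu> (\<lambda>x. f x - g x) \<le> E g"
    unfolding E_def[of g]
  proof (rule cINF_greatest)
    fix w :: "'a \<Rightarrow> 'a" assume w: "w \<in> C1"
    have "L * norm2 \<mu> (\<lambda>x. f x - w x)
        \<le> L * (norm2 \<mu> (\<lambda>x. f x - g x) + norm2 \<mu> (\<lambda>x. g x - w x))"
      using norm2_triangle_diff[OF f g C1_sq[OF w]] L_nonneg by (rule mult_left_mono)
    then show "E f - L * norm2 \<mu> (\<lambda>x. f x - g x) \<le> D w + L * norm2 \<mu> (\<lambda>x. g x - w x)"
      using E_le[OF f w] by (simp add: algebra_simps)
  qed (use C1_zero in blast)
  then show ?thesis by simp
qed

lemma E_lipschitz:
  assumes f: "sq_integrable \<mu> f" and g: "sq_integrable \<mu> g"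
  shows "\<bar>E f - E g\<bar> \<le> L * norm2 \<mu> (\<lambda>x. f x - g x)"
  using E_le_add[OF f g] E_le_add[OF g f] norm2_diff_commute[of \<mu> f g] by simp

text \<open>The form in which density is used: \<open>E f\<close> is exchanged for
  \<open>D w\<close> at a cost proportional to \<open>s\<close>.\<close>

lemma C1_close:
  assumes f: "sq_integrable \<mu> f" and s: "0 < s"
  obtains w where "w \<in> C1" "norm2 \<mu> (\<lambda>x. f x - w x) < s" "\<bar>E f - D w\<bar> \<le> L * s"
proof -
  obtain w where w: "w \<in> C1" "norm2 \<mu> (\<lambda>x. f x - w x) < s"
    using C1_dense[OF \<mu> f s] by blast
  have "\<bar>E f - D w\<bar> \<le> L * norm2 \<mu> (\<lambda>x. f x - w x)"
    using E_lipschitz[OF f C1_sq[OF w(1)]] E_eq_D[OF w(1)] by simp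
  also have "\<dots> \<le> L * s" using w(2) L_nonneg by (intro mult_left_mono) auto
  finally show ?thesis using that w by blast
qed

text \<open>McShane's formula provides the Lipschitz bound directly; subadditivity and homogeneity
  are carried over from \<open>D\<close> by density.\<close>

sublocale E: sublinear_lipschitz_functional \<mu> E L
proof
  show "0 \<le> L" by (rule L_nonneg)
  show "\<bar>E f - E g\<bar> \<le> L * norm2 \<mu> (\<lambda>x. f x - g x)"
    if "sq_integrable \<mu> f" "sq_integrable \<mu> g" for f g
    by (rule E_lipschitz[OF that])
  show "E (\<lambda>x. f x + g x) \<le> E f + E g"
    if f: "sq_integrable \<mu> f" and g: "sq_integrable \<mu> g" for f g
  proof (rule le_of_le_add_mult[of _ _ "4 * L"])
    fix s :: real assume s: "0 < s"
    obtain v where v: "v \<in> C1" "norm2 \<mu> (\<lambda>x. f x - v x) < s" "\<bar>E f - D v\<bar> \<le> L * s"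
      using C1_close[OF f s] by blast
    obtain w where w: "w \<in> C1" "norm2 \<mu> (\<lambda>x. g x - w x) < s" "\<bar>E g - D w\<bar> \<le> L * s"
      using C1_close[OF g s] by blast
    have "norm2 \<mu> (\<lambda>x. (f x + g x) - (v x + w x)) \<le> norm2 \<mu> (\<lambda>x. f x - v x) + norm2 \<mu> (\<lambda>x. g x - w x)"
      using norm2_triangle[OF sq_integrable_diff[OF f C1_sq[OF v(1)]] sq_integrable_diff[OF g C1_sq[OF w(1)]]]
      by (simp add: algebra_simps)
    also have "\<dots> \<le> 2 * s" using v(2) w(2) by simp
    finally have "L * norm2 \<mu> (\<lambda>x. (f x + g x) - (v x + w x)) \<le> L * (2 * s)"
      using L_nonneg by (rule mult_left_mono)
    then have "E (\<lambda>x. f x + g x) \<le> D (\<lambda>x. v x + w x) + 2 * (L * s)"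
      using E_le[OF sq_integrable_add[OF f g] C1_add[OF v(1) w(1)]] by simp
    \<comment> \<open>Replacing the sum by its approximant costs \<open>2 * (L * s)\<close>, and
      returning from \<open>D v\<close> and \<open>D w\<close> to \<open>E f\<close> and
      \<open>E g\<close> costs \<open>L * s\<close> each.\<close>
    then show "E (\<lambda>x. f x + g x) \<le> E f + E g + 4 * L * s"
      using D_add_le[OF v(1) w(1)] v(3) w(3) by simp
  qed
  show "E (\<lambda>x. c *\<^sub>R f x) = c * E f" if f: "sq_integrable \<mu> f" and c: "0 \<le> c" for f c
  proof -
    have "\<bar>E (\<lambda>x. c *\<^sub>R f x) - c * E f\<bar> \<le> 0"
    proof (rule le_of_le_add_mult[of _ _ "2 * (c * L)"])
      fix s :: real assume s: "0 < s"
      obtain w where w: "w \<in> C1" "norm2 \<mu> (\<lambda>x. f x - w x) < s" "\<bar>E f - D w\<bar> \<le> L * s"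
        using C1_close[OF f s] by blast
      have "norm2 \<mu> (\<lambda>x. c *\<^sub>R f x - c *\<^sub>R w x) = c * norm2 \<mu> (\<lambda>x. f x - w x)"
        using c norm2_scaleR[of \<mu> c "\<lambda>x. f x - w x"] by (simp add: scaleR_diff_right)
      also have "\<dots> \<le> c * s" using w(2) c by (intro mult_left_mono) auto
      finally have "L * norm2 \<mu> (\<lambda>x. c *\<^sub>R f x - c *\<^sub>R w x) \<le> L * (c * s)"
        using L_nonneg by (rule mult_left_mono)
      then have "\<bar>E (\<lambda>x. c *\<^sub>R f x) - c * D w\<bar> \<le> c * L * s"
        using E_lipschitz[OF sq_integrable_scaleR[OF f, of c] C1_sq[OF C1_scaleR[OF w(1), of c]]]
        by (simp add: E_eq_D[OF C1_scaleR[OF w(1)]] D_scaleR[OF w(1) c] mult_ac)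
      moreover have "\<bar>c * D w - c * E f\<bar> \<le> c * L * s"
        using mult_left_mono[OF w(3) c] c
        by (simp add: right_diff_distrib[symmetric] abs_mult abs_minus_commute mult.assoc)
      ultimately show "\<bar>E (\<lambda>x. c *\<^sub>R f x) - c * E f\<bar> \<le> 0 + 2 * (c * L) * s" by linarith
    qed
    then show ?thesis by simp
  qed
qed

lemma is_cont_extension_E: "is_cont_extension \<G> \<mu> (restrict E (L2 \<mu>))"
  unfolding is_cont_extension_def
proof (intro conjI ballI)
  show "L2_continuous \<mu> (restrict E (L2 \<mu>))"
    unfolding L2_continuous_def L2_norm_eq
  proof (intro ballI allI impI)
    fix f and e :: real assume f: "f \<in> L2 \<mu>" and e: "0 < e"
    show "\<exists>d>0. \<forall>g\<in>L2 \<mu>. norm2 \<mu> (\<lambda>x. g x - f x) < d \<longrightarrow>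
      \<bar>restrict E (L2 \<mu>) g - restrict E (L2 \<mu>) f\<bar> < e"
    proof (intro exI[of _ "e / (L + 1)"] conjI ballI impI)
      show "0 < e / (L + 1)" using e L_nonneg by simp
      fix g assume g: "g \<in> L2 \<mu>" and d: "norm2 \<mu> (\<lambda>x. g x - f x) < e / (L + 1)"
      have "\<bar>E g - E f\<bar> \<le> L * norm2 \<mu> (\<lambda>x. g x - f x)"
        using f g by (intro E_lipschitz) (auto simp: L2_iff)
      also have "\<dots> \<le> (L + 1) * norm2 \<mu> (\<lambda>x. g x - f x)" by (intro mult_right_mono) auto
      also have "\<dots> < e" using d L_nonneg by (simp add: pos_less_divide_eq mult.commute)
      finally show "\<bar>restrict E (L2 \<mu>) g - restrict E (L2 \<mu>) f\<bar> < e" using f g by simp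
    qed
  qed
  show "ereal (restrict E (L2 \<mu>) w) = gen_deriv \<G> \<mu> w" if "w \<in> C1" for w
    using C1_sq[OF that] by (simp add: L2_iff E_eq_D[OF that] gen_deriv_eq_D(1)[OF that])
qed simp

lemma is_cont_extension_unique:
  assumes "is_cont_extension \<G> \<mu> F"
  shows "F = restrict E (L2 \<mu>)"
proof (rule extensionalityI)
  show "F \<in> extensional (L2 \<mu>)" using assms by (simp add: is_cont_extension_def)
  fix f assume f: "f \<in> L2 \<mu>"
  have "\<bar>F f - E f\<bar> \<le> 0"
  proof (rule le_of_le_add_mult[of _ _ "1 + L"])
    fix s :: real assume s: "0 < s"
    obtain d where d: "0 < d" "\<And>g. g \<in> L2 \<mu> \<Longrightarrow> norm2 \<mu> (\<lambda>x. g x - f x) < d \<Longrightarrow> \<bar>F g - F f\<bar> < s"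
      using assms f s unfolding is_cont_extension_def L2_continuous_def L2_norm_eq by blast
    \<comment> \<open>\<open>d\<close> serves the continuity of \<open>F\<close>, and
      \<open>s\<close> the Lipschitz bound on \<open>E\<close>.\<close>
    have "0 < min d s" using d(1) s by simp
    from C1_close[OF _ this] f obtain w where w: "w \<in> C1" "norm2 \<mu> (\<lambda>x. f x - w x) < min d s"
      "\<bar>E f - D w\<bar> \<le> L * min d s" by (auto simp: L2_iff)
    have "\<bar>F w - F f\<bar> < s"
      using w C1_sq[OF w(1)] norm2_diff_commute[of \<mu> w f] by (intro d(2)) (auto simp: L2_iff)
    moreover have "F w = D w"
      using assms w(1) gen_deriv_eq_D(1)[OF w(1)] unfolding is_cont_extension_def by force
    moreover have "L * min d s \<le> L * s" using L_nonneg by (intro mult_left_mono) auto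
    ultimately show "\<bar>F f - E f\<bar> \<le> 0 + (1 + L) * s" using w(3) by (simp add: algebra_simps)
  qed
  then show "F f = restrict E (L2 \<mu>) f" using f by simp
qed simp

lemma gen_deriv_ext_eq: "gen_deriv_ext \<G> \<mu> = restrict E (L2 \<mu>)"
  unfolding gen_deriv_ext_def
  by (intro the_equality is_cont_extension_E is_cont_extension_unique)

text \<open>The Clarke subdifferential is tested on \<open>C1\<close> only. Both sides of its
  defining inequality are continuous in the test map, so density extends it to all square-integrable
  maps.\<close>

lemma clarke_subdiff_eq: "clarke_subdiff \<G> \<mu> = Collect E.subgradient"
proof (intro set_eqI iffI)
  fix \<Xi> assume "\<Xi> \<in> Collect E.subgradient"
  then show "\<Xi> \<in> clarke_subdiff \<G> \<mu>"
    by (auto simp: clarke_subdiff_def E.subgradient_def L2_iff L2_inner_def C1_sq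
        gen_deriv_eq_D(1) E_eq_D[symmetric])
next
  fix \<Xi> assume "\<Xi> \<in> clarke_subdiff \<G> \<mu>"
  then have \<Xi>: "sq_integrable \<mu> \<Xi>" and C: "\<And>w. w \<in> C1 \<Longrightarrow> (\<integral>x. \<Xi> x \<bullet> w x \<partial>\<mu>) \<le> D w"
    using gen_deriv_eq_D(1) by (auto simp: clarke_subdiff_def L2_iff L2_inner_def)
  have "(\<integral>x. \<Xi> x \<bullet> f x \<partial>\<mu>) \<le> E f" if f: "sq_integrable \<mu> f" for f
  proof (rule le_of_le_add_mult[of _ _ "L + norm2 \<mu> \<Xi>"])
    fix s :: real assume s: "0 < s"
    obtain w where w: "w \<in> C1" "norm2 \<mu> (\<lambda>x. f x - w x) < s" "\<bar>E f - D w\<bar> \<le> L * s"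
      using C1_close[OF f s] by blast
    have "(\<integral>x. \<Xi> x \<bullet> f x \<partial>\<mu>) - (\<integral>x. \<Xi> x \<bullet> w x \<partial>\<mu>) = (\<integral>x. \<Xi> x \<bullet> (f x - w x) \<partial>\<mu>)"
      using integrable_inner[OF \<Xi> f] integrable_inner[OF \<Xi> C1_sq[OF w(1)]]
      by (simp add: inner_diff_right)
    also have "\<dots> \<le> norm2 \<mu> \<Xi> * norm2 \<mu> (\<lambda>x. f x - w x)"
      using norm2_Cauchy_Schwarz[OF \<Xi> sq_integrable_diff[OF f C1_sq[OF w(1)]]] by simp
    also have "\<dots> \<le> norm2 \<mu> \<Xi> * s" using w(2) by (intro mult_left_mono) auto
    finally show "(\<integral>x. \<Xi> x \<bullet> f x \<partial>\<mu>) \<le> E f + (L + norm2 \<mu> \<Xi>) * s"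
      using C[OF w(1)] w(3) by (simp add: algebra_simps)
  qed
  then show "\<Xi> \<in> Collect E.subgradient" using \<Xi> by (simp add: E.subgradient_def)
qed

section \<open>Convexity and weak closedness of the Clarke subdifferential\<close>

lemma clarke_subdiff_convex: "L2_convex (clarke_subdiff \<G> \<mu>)"
  unfolding L2_convex_def clarke_subdiff_eq
proof (intro ballI)
  fix f g and s :: real assume fg: "f \<in> Collect E.subgradient" "g \<in> Collect E.subgradient" and s: "s \<in> {0..1}"
  then have sq: "sq_integrable \<mu> f" "sq_integrable \<mu> g" by (auto simp: E.subgradient_def)
  have "(\<integral>x. ((1 - s) *\<^sub>R f x + s *\<^sub>R g x) \<bullet> w x \<partial>\<mu>) \<le> E w" if w: "sq_integrable \<mu> w" for w
  proof -
    have "(\<integral>x. ((1 - s) *\<^sub>R f x + s *\<^sub>R g x) \<bullet> w x \<partial>\<mu>)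
        = (1 - s) * (\<integral>x. f x \<bullet> w x \<partial>\<mu>) + s * (\<integral>x. g x \<bullet> w x \<partial>\<mu>)"
      using integrable_inner[OF sq(1) w] integrable_inner[OF sq(2) w] by (simp add: inner_add_left)
    also have "\<dots> \<le> (1 - s) * E w + s * E w"
      using fg w s by (intro add_mono mult_left_mono) (auto simp: E.subgradient_def)
    finally show ?thesis by (simp add: algebra_simps)
  qed
  then show "(\<lambda>x. (1 - s) *\<^sub>R f x + s *\<^sub>R g x) \<in> Collect E.subgradient"
    using sq by (simp add: E.subgradient_def sq_integrable_add sq_integrable_scaleR)
qed

text \<open>The defining inequalities are closed half-spaces, one for each map in \<open>C1\<close>,
  so the complement is a union of weakly open half-spaces.\<close>

lemma clarke_subdiff_weakly_closed: "closedin (L2_weak_topology \<mu>) (clarke_subdiff \<G> \<mu>)"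
proof -
  let ?B = "{{f \<in> L2 \<mu>. L2_inner \<mu> f g \<in> V} |g V. g \<in> L2 \<mu> \<and> open V}"
  \<comment> \<open>The generating family contains the whole space, by testing against the zero map,
    so the underlying set of the generated topology is \<open>L2 \<mu>\<close>.\<close>
  have "L2 \<mu> \<in> ?B"
    using C1_sq[OF C1_zero] by (auto simp: L2_iff intro!: exI[of _ "\<lambda>x. 0"] exI[of _ UNIV])
  then have top: "topspace (L2_weak_topology \<mu>) = L2 \<mu>"
    unfolding L2_weak_topology_def topology_generated_by_topspace by auto
  have "L2 \<mu> - clarke_subdiff \<G> \<mu> = (\<Union>w\<in>C1. {f \<in> L2 \<mu>. L2_inner \<mu> f w \<in> {D w<..}})"
    using gen_deriv_eq_D(1) by (auto simp: clarke_subdiff_def)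
  moreover have "openin (L2_weak_topology \<mu>) {f \<in> L2 \<mu>. L2_inner \<mu> f w \<in> {D w<..}}" if "w \<in> C1" for w
    unfolding L2_weak_topology_def using C1_sq[OF that]
    by (intro topology_generated_by_Basis CollectI exI[of _ w] exI[of _ "{D w<..}"]) (auto simp: L2_iff)
  ultimately have "openin (L2_weak_topology \<mu>) (L2 \<mu> - clarke_subdiff \<G> \<mu>)"
    by (metis (no_types, lifting) openin_Union image_iff)
  then show ?thesis
    unfolding closedin_def top by (simp add: clarke_subdiff_def)
qed

end

theorem proposition4p4:
  fixes \<G> :: "(real ^ 'd) measure \<Rightarrow> real"
    and \<mu> :: "(real ^ 'd) measure"
    and L :: real
  assumes "\<mu> \<in> P2"
    and "W2_lipschitz_around L \<mu> \<G>"
  shows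
    "(\<forall>w\<in>C1. \<bar>gen_deriv \<G> \<mu> w\<bar> \<le> ereal (L * L2_norm \<mu> w))
     \<and> (\<forall>w1\<in>C1. \<forall>w2\<in>C1. \<bar>gen_deriv \<G> \<mu> w2 - gen_deriv \<G> \<mu> w1\<bar>
            \<le> ereal (L * L2_norm \<mu> (\<lambda>x. w2 x - w1 x)))
     \<and> ((\<exists>!E. is_cont_extension \<G> \<mu> E)
        \<and> (\<forall>\<beta>\<in>L2 \<mu>. \<forall>c\<ge>0. gen_deriv_ext \<G> \<mu> (\<lambda>x. c *\<^sub>R \<beta> x) = c * gen_deriv_ext \<G> \<mu> \<beta>)
        \<and> (\<forall>\<beta>\<in>L2 \<mu>. \<forall>\<beta>'\<in>L2 \<mu>. \<bar>gen_deriv_ext \<G> \<mu> \<beta> - gen_deriv_ext \<G> \<mu> \<beta>'\<bar>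
             \<le> L * L2_norm \<mu> (\<lambda>x. \<beta> x - \<beta>' x)))
     \<and> (\<forall>w\<in>C1. \<forall>U. W2_open U \<and> \<mu> \<in> U \<and> (\<exists>K. W2_lipschitz_on K U \<G>)
            \<longrightarrow> W2_usc_on U (\<lambda>\<nu>. gen_deriv \<G> \<nu> w))
     \<and> (clarke_subdiff \<G> \<mu> \<noteq> {} \<and> L2_convex (clarke_subdiff \<G> \<mu>)
        \<and> closedin (L2_weak_topology \<mu>) (clarke_subdiff \<G> \<mu>))
     \<and> (\<forall>\<Xi>\<in>clarke_subdiff \<G> \<mu>. L2_norm \<mu> \<Xi> \<le> L)
     \<and> (\<forall>\<beta>\<in>L2 \<mu>. ereal (gen_deriv_ext \<G> \<mu> \<beta>)
            = (SUP \<Xi>\<in>clarke_subdiff \<G> \<mu>. ereal (L2_inner \<mu> \<Xi> \<beta>)))"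
proof -
  obtain r where "0 < r" "W2_lipschitz_on L (W2_ball \<mu> r) \<G>"
    using assms(2) by (auto simp: W2_lipschitz_around_def)
  then interpret W2_lipschitz_near \<G> \<mu> L r
    using assms(1) by unfold_locales
  show ?thesis
    unfolding L2_norm_eq gen_deriv_ext_eq
  proof (intro conjI ballI allI impI)
    show "\<bar>gen_deriv \<G> \<mu> w\<bar> \<le> ereal (L * norm2 \<mu> w)" if "w \<in> C1" for w
      using gen_deriv_eq_D[OF that] by simp
    show "\<bar>gen_deriv \<G> \<mu> w2 - gen_deriv \<G> \<mu> w1\<bar> \<le> ereal (L * norm2 \<mu> (\<lambda>x. w2 x - w1 x))"
      if "w1 \<in> C1" "w2 \<in> C1" for w1 w2
      using D_lipschitz[OF that] that by (simp add: gen_deriv_eq_D(1))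
    show "\<exists>!E. is_cont_extension \<G> \<mu> E"
      using is_cont_extension_E is_cont_extension_unique by blast
    show "restrict E (L2 \<mu>) (\<lambda>x. c *\<^sub>R \<beta> x) = c * restrict E (L2 \<mu>) \<beta>"
      if "\<beta> \<in> L2 \<mu>" "0 \<le> c" for \<beta> c
      using that by (simp add: L2_iff sq_integrable_scaleR E.homogeneous)
    show "\<bar>restrict E (L2 \<mu>) \<beta> - restrict E (L2 \<mu>) \<beta>'\<bar> \<le> L * norm2 \<mu> (\<lambda>x. \<beta> x - \<beta>' x)"
      if "\<beta> \<in> L2 \<mu>" "\<beta>' \<in> L2 \<mu>" for \<beta> \<beta>'
      using that by (simp add: L2_iff E_lipschitz)
    show "W2_usc_on U (\<lambda>\<nu>. gen_deriv \<G> \<nu> w)"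
      if "W2_open U \<and> \<mu> \<in> U \<and> (\<exists>K. W2_lipschitz_on K U \<G>)" for w U
      using that gen_deriv_upper_semicontinuous by blast
    show "clarke_subdiff \<G> \<mu> \<noteq> {}"
      using E.subgradient_exists by (auto simp: clarke_subdiff_eq)
    show "norm2 \<mu> \<Xi> \<le> L" if "\<Xi> \<in> clarke_subdiff \<G> \<mu>" for \<Xi>
      using that by (simp add: clarke_subdiff_eq E.subgradient_norm_le)
    show "ereal (restrict E (L2 \<mu>) \<beta>) = (SUP \<Xi>\<in>clarke_subdiff \<G> \<mu>. ereal (L2_inner \<mu> \<Xi> \<beta>))"
      if "\<beta> \<in> L2 \<mu>" for \<beta>
      using that E.support_function[of \<beta>] by (simp add: L2_iff clarke_subdiff_eq L2_inner_def)
  qed (rule clarke_subdiff_convex clarke_subdiff_weakly_closed)+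
qed

end
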